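(* Let $\mathcal{X}$ be a Polish space with Borel $\sigma$-algebra $\mathcal{B}$, let $n\ge 1$ and $\lambda=(\lambda_1,\ldots,\lambda_n)\in\Lambda^n$, and let $P_n$ be the distribution of a $\lambda$-exchangeable sequence $(X_1,\ldots,X_n)$ on $\mathcal{X}$. Let $1\le k\le n$ and let $P_k$ be the marginal distribution of $(X_1,\ldots,X_k)$. Assume that $$r_i:=\frac{\inf_{x\in\mathcal{X}}\lambda_i(x)}{\sup_{x\in\mathcal{X}}\lambda_i(x)}>0\quad\text{for all } i\in\{1,\ldots,n\}.$$ Then there exists a mixture of weighted i.i.d. distributions $Q_n$ on $\mathcal{X}^n$ (with respect to the weights $\lambda$), with $Q_{n,k}$ denoting its marginal distribution on the first $k$ coordinates, such that $$|P_k-Q_{n,k}|_{TV}\le \frac{k(k-1)}{2n}\left(\prod_{i=1}^k r_i\right)^{-1}+\frac{\left(\prod_{i=k+1}^n r_i\right)^{-1/2}-1}{\left(\prod_{i=k+1}^n r_i\right)^{-1/2}+1}.$$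
   Context: $\Lambda$ is the set of measurable functions $\mathcal{X}\to(0,\infty)$, and $\Lambda^n$ its $n$-fold product. $\mathcal{B}^n$ is the Borel $\sigma$-algebra of $\mathcal{X}^n$. A probability measure $P_n$ on $(\mathcal{X}^n,\mathcal{B}^n)$ (or a random sequence $(X_1,\ldots,X_n)$ with this distribution) is called $\lambda$-exchangeable, for $\lambda=(\lambda_1,\ldots,\lambda_n)\in\Lambda^n$, if the measure $\overline{P}_n$ defined by $\overline{P}_n(B)=\int_B \frac{dP_n(x_1,\ldots,x_n)}{\prod_{i=1}^n\lambda_i(x_i)}$, $B\in\mathcal{B}^n$, is an exchangeable probability measure (i.e. invariant under all permutations of the $n$ coordinates). For a probability measure $\mu$ on $\mathcal{X}$ and a bounded $\lambda_i\in\Lambda$, let $T_i\mu$ be the probability measure $T_i\mu(dx)=\lambda_i(x)\mu(dx)/\int\lambda_i\,d\mu$. A weighted i.i.d. distribution on $\mathcal{X}^n$ is a product measure $\otimes_{i=1}^n T_i\mu$ with $\mu$ a probability measure on $\mathcal{X}$. A mixture of weighted i.i.d. distributions on $\mathcal{X}^n$ is a measure of the form $\int_{\mathcal{P}(\mathcal{X})}\otimes_{i=1}^n T_i\mu\,\Pi(d\mu)$ with $\Pi$ a probability measure on the space $\mathcal{P}(\mathcal{X})$ of probability measures on $\mathcal{X}$ (with the Borel $\sigma$-algebra of the weak topology). The total variation distance is $|P-Q|_{TV}:=\sup_A|P(A)-Q(A)|$ over measurable sets $A$. Empty products equal $1$. *)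

theory Defs
  imports "HOL-Probability.Probability" "HOL-Combinatorics.Permutations"
begin

definition weights :: "('a::topological_space \<Rightarrow> real) set" where
  "weights = {f \<in> borel_measurable borel. \<forall>x. 0 < f x}"

text \<open>
  Points of \<open>X^n\<close> are functions on the index set \<open>{1..n}\<close>. For second countable \<open>X\<close> the
  product \<open>\<sigma>\<close>-algebra used here is the Borel \<open>\<sigma>\<close>-algebra of \<open>X^n\<close>.
\<close>

abbreviation borel_power :: "nat \<Rightarrow> (nat \<Rightarrow> 'a::topological_space) measure" where
  "borel_power n \<equiv> PiM {1..n} (\<lambda>_. borel)"

definition exchangeable :: "nat \<Rightarrow> (nat \<Rightarrow> 'a::topological_space) measure \<Rightarrow> bool" where
  "exchangeable n M \<longleftrightarrow>
     sets M = sets (borel_power n) \<and>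
     (\<forall>\<pi>. \<pi> permutes {1..n} \<longrightarrow>
        distr M (borel_power n) (\<lambda>x. \<lambda>i\<in>{1..n}. x (\<pi> i)) = M)"

definition unweighted ::
    "nat \<Rightarrow> (nat \<Rightarrow> 'a \<Rightarrow> real) \<Rightarrow> (nat \<Rightarrow> 'a::topological_space) measure \<Rightarrow> (nat \<Rightarrow> 'a) measure" where
  "unweighted n l P = density P (\<lambda>x. ennreal (1 / (\<Prod>i=1..n. l i (x i))))"

definition weighted_exchangeable ::
    "nat \<Rightarrow> (nat \<Rightarrow> 'a \<Rightarrow> real) \<Rightarrow> (nat \<Rightarrow> 'a::topological_space) measure \<Rightarrow> bool" where
  "weighted_exchangeable n l P \<longleftrightarrow>
     prob_space P \<and> sets P = sets (borel_power n) \<and>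
     prob_space (unweighted n l P) \<and> exchangeable n (unweighted n l P)"

text \<open>
  The quotient is formed in \<open>ereal\<close>, so that it is \<open>0\<close> when the supremum is infinite.
\<close>

definition weight_ratio :: "('a \<Rightarrow> real) \<Rightarrow> real" where
  "weight_ratio f = real_of_ereal ((INF x. ereal (f x)) / (SUP x. ereal (f x)))"

definition tilt :: "('a \<Rightarrow> real) \<Rightarrow> 'a measure \<Rightarrow> 'a measure" where
  "tilt f \<mu> = density \<mu> (\<lambda>x. ennreal (f x / (\<integral>y. f y \<partial>\<mu>)))"

definition weighted_iid ::
    "nat \<Rightarrow> (nat \<Rightarrow> 'a \<Rightarrow> real) \<Rightarrow> 'a measure \<Rightarrow> (nat \<Rightarrow> 'a) measure" where
  "weighted_iid n l \<mu> = PiM {1..n} (\<lambda>i. tilt (l i) \<mu>)"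

definition prob_measures :: "'a::topological_space measure set" where
  "prob_measures = {\<mu>. sets \<mu> = sets borel \<and> prob_space \<mu>}"

text \<open>
  The coarsest topology on \<^const>\<open>prob_measures\<close> for which \<open>\<mu> \<mapsto> \<integral>f d\<mu>\<close> is continuous for
  every bounded continuous \<open>f\<close>.
\<close>

definition weak_topology :: "'a::topological_space measure topology" where
  "weak_topology = topology_generated_by
     {{\<mu> \<in> prob_measures. (\<integral>x. f x \<partial>\<mu>) \<in> U} | (f :: 'a \<Rightarrow> real) U.
        continuous_on UNIV f \<and> bounded (range f) \<and> open U}"

definition weak_borel :: "'a::topological_space measure measure" where
  "weak_borel = sigma prob_measures {U. openin weak_topology U}"

definition mixture_of_weighted_iid ::
    "nat \<Rightarrow> (nat \<Rightarrow> 'a \<Rightarrow> real) \<Rightarrow> (nat \<Rightarrow> 'a::topological_space) measure \<Rightarrow> bool" where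
  "mixture_of_weighted_iid n l Q \<longleftrightarrow>
     sets Q = sets (borel_power n) \<and>
     (\<exists>R. prob_space R \<and> sets R = sets weak_borel \<and>
        (\<forall>A\<in>sets (borel_power n). emeasure Q A = (\<integral>\<^sup>+\<mu>. emeasure (weighted_iid n l \<mu>) A \<partial>R)))"

definition marginal :: "nat \<Rightarrow> (nat \<Rightarrow> 'a::topological_space) measure \<Rightarrow> (nat \<Rightarrow> 'a) measure" where
  "marginal k P = distr P (borel_power k) (\<lambda>x. restrict x {1..k})"

text \<open>Meaningful for probability measures with the same measurable sets.\<close>

definition tv_dist :: "'a measure \<Rightarrow> 'a measure \<Rightarrow> real" where
  "tv_dist P Q = (SUP A\<in>sets P. \<bar>measure P A - measure Q A\<bar>)"

lemma topspace_weak_topology [simp]: "topspace weak_topology = prob_measures"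
proof -
  have "prob_measures \<in> {{\<mu> \<in> prob_measures. (\<integral>x. f x \<partial>\<mu>) \<in> U} | (f :: 'a \<Rightarrow> real) U.
        continuous_on UNIV f \<and> bounded (range f) \<and> open U}"
    by (rule CollectI, rule exI[of _ "\<lambda>_. 0"], rule exI[of _ UNIV]) auto
  then show ?thesis
    unfolding weak_topology_def topology_generated_by_topspace by blast
qed

lemma space_weak_borel [simp]: "space weak_borel = prob_measures"
  unfolding weak_borel_def by (rule space_measure_of) (use openin_subset in fastforce)

lemma sets_weak_borel: "sets weak_borel = sigma_sets prob_measures {U. openin weak_topology U}"
  unfolding weak_borel_def by (rule sets_measure_of) (use openin_subset in fastforce)

end

theory Submission
  imports Defs
begin

text \<open>
  Let \<open>M\<close> be the exchangeable law obtained from \<open>P\<close> by removing the weights, so that \<open>P\<close> has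
  density \<open>\<Prod>i=1..n. l i (x i)\<close> with respect to \<open>M\<close>. Split this density as \<open>f * g\<close>, with \<open>f\<close> the
  product over \<open>i \<le> k\<close> and \<open>g\<close> the product over \<open>i > k\<close>. The proof passes from the marginal of \<open>P\<close>
  to that of the mixture in two steps, one for each summand of the bound.

  The first step drops \<open>g\<close>: the law \<open>P\<close> has density proportional to \<open>g\<close> with respect to
  \<open>tilt f M\<close>. A density whose extreme values have ratio at most \<open>\<rho>\<close> moves every event by at most
  \<open>(sqrt \<rho> - 1) / (sqrt \<rho> + 1)\<close> (\<open>measure_diff_density_le\<close>), and here \<open>\<rho>\<close> is the inverse of the
  product of the weight ratios over \<open>i > k\<close>. Since \<open>f\<close> depends on the first \<open>k\<close> coordinates only,
  the \<open>k\<close>-marginal of \<open>tilt f M\<close> is \<open>tilt f p\<close>, where \<open>p\<close> is the \<open>k\<close>-marginal of \<open>M\<close>.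

  The second step is the argument of Diaconis and Freedman for finite exchangeable sequences. By
  exchangeability, \<open>p\<close> is the law of \<open>k\<close> draws without replacement from the coordinates of an
  \<open>M\<close>-random point. Let \<open>q\<close> be the corresponding law of draws with replacement; it is a mixture of
  powers of the empirical measure. If \<open>\<beta>\<close> denotes the probability that \<open>k\<close> uniform indices are
  distinct, then \<open>q\<close> dominates \<open>\<beta> p\<close> (\<open>with_replacement_ge\<close>) and
  \<open>1 - \<beta> \<le> k (k - 1) / (2 n)\<close> (\<open>card_injections_ge\<close>). Domination survives the tilt at the cost of the
  factor \<open>sup f / inf f\<close> (\<open>measure_diff_tilt_le\<close>), which gives the first summand.

  It remains to recognise \<open>tilt f q\<close> as the \<open>k\<close>-marginal of a mixture of weighted i.i.d. laws
  (\<open>ex_mixture_marginal_eq_tilt\<close>): the mixing measure charges empirical measures, reweighted by the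
  normalising constants of their first \<open>k\<close> tilts. For this to be a mixture over the weak Borel
  structure, the empirical measure must depend measurably on the point, which follows from
  continuity, and the weighted product must depend measurably on the underlying measure.
\<close>

section \<open>Empirical measures and the weak topology\<close>

lemma borel_measurable_weak_borel_integral:
  fixes f :: "'a::topological_space \<Rightarrow> real"
  assumes "continuous_on UNIV f" "bounded (range f)"
  shows "(\<lambda>\<mu>. \<integral>x. f x \<partial>\<mu>) \<in> borel_measurable weak_borel"
proof (rule borel_measurableI)
  fix U :: "real set" assume "open U"
  then have "openin weak_topology {\<mu> \<in> prob_measures. (\<integral>x. f x \<partial>\<mu>) \<in> U}"
    unfolding weak_topology_def using assms by (intro topology_generated_by_Basis) blast
  moreover have "(\<lambda>\<mu>. \<integral>x. f x \<partial>\<mu>) -` U \<inter> space weak_borel = {\<mu> \<in> prob_measures. (\<integral>x. f x \<partial>\<mu>) \<in> U}"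
    by auto
  ultimately show "(\<lambda>\<mu>. \<integral>x. f x \<partial>\<mu>) -` U \<inter> space weak_borel \<in> sets weak_borel"
    by (auto simp: sets_weak_borel)
qed

text \<open>
  The indicator of a closed set is the pointwise limit of the bounded continuous functions
  \<open>max 0 (1 - m * infdist x F)\<close>, so by dominated convergence its integral is a limit of
  measurable functions of the measure.
\<close>

lemma borel_measurable_weak_borel_closed:
  fixes F :: "'a::metric_space set"
  assumes "closed F"
  shows "(\<lambda>\<mu>. measure \<mu> F) \<in> borel_measurable weak_borel"
proof (cases "F = {}")
  case True
  then show ?thesis by simp
next
  case False
  define u where "u m x = max 0 (1 - real m * infdist x F)" for m x
  have u_bound: "\<bar>u m x\<bar> \<le> 1" for m x
    unfolding u_def using infdist_nonneg[of x F] by (auto simp: max_def)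
  have u_cont: "continuous_on UNIV (u m)" for m
    unfolding u_def by (intro continuous_intros)
  have u_lim: "(\<lambda>m. u m x) \<longlonglongrightarrow> indicator F x" for x
  proof (cases "x \<in> F")
    case True
    then show ?thesis by (simp add: u_def)
  next
    case False
    then have pos: "infdist x F > 0"
      using assms \<open>F \<noteq> {}\<close> infdist_nonneg[of x F] by (simp add: in_closed_iff_infdist_zero less_le)
    have "eventually (\<lambda>m. u m x = 0) sequentially"
    proof -
      obtain m0 where "1 / infdist x F < real m0"
        using reals_Archimedean2 by blast
      then have "u m x = 0" if "m \<ge> m0" for m
      proof -
        have "1 / infdist x F \<le> real m"
          using that \<open>1 / infdist x F < real m0\<close> by linarith
        then have "1 \<le> real m * infdist x F"
          using pos by (simp add: field_simps)
        then show ?thesis by (simp add: u_def)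
      qed
      then show ?thesis by (auto simp: eventually_sequentially)
    qed
    with False show ?thesis
      by (simp add: tendsto_eventually)
  qed
  show ?thesis
  proof (rule borel_measurable_LIMSEQ_real)
    show "(\<lambda>\<mu>. \<integral>x. u m x \<partial>\<mu>) \<in> borel_measurable weak_borel" for m
      using u_bound by (intro borel_measurable_weak_borel_integral u_cont)
        (auto simp: bounded_iff intro!: exI[of _ 1])
  next
    fix \<mu> :: "'a measure" assume "\<mu> \<in> space weak_borel"
    then have s: "sets \<mu> = sets borel" and "prob_space \<mu>"
      by (auto simp: prob_measures_def)
    interpret prob_space \<mu> by fact
    have F: "F \<in> sets \<mu>" using assms s by simp
    have "(\<lambda>m. \<integral>x. u m x \<partial>\<mu>) \<longlonglongrightarrow> (\<integral>x. indicator F x \<partial>\<mu>)"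
    proof (rule integral_dominated_convergence[where w = "\<lambda>_. 1"])
      show "u m \<in> borel_measurable \<mu>" for m
        using borel_measurable_continuous_onI[OF u_cont[of m]] s
        by (simp cong: measurable_cong_sets)
    qed (use F u_bound u_lim in auto)
    then show "(\<lambda>m. \<integral>x. u m x \<partial>\<mu>) \<longlonglongrightarrow> measure \<mu> F"
      using F by simp
  qed
qed

text \<open>
  Closed sets are an intersection-stable generator of the Borel sets; hence every evaluation
  \<open>\<mu> \<mapsto> \<mu> A\<close> is measurable for the weak Borel structure. This connects mixtures over
  \<^const>\<open>weak_borel\<close> with the kernels of the Giry monad.
\<close>

lemma weak_borel_measurable_prob_algebra:
  "(\<lambda>\<mu>. \<mu>) \<in> weak_borel \<rightarrow>\<^sub>M prob_algebra (borel :: 'a::metric_space measure)"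
proof (rule measurable_prob_algebra_generated)
  show "sets borel = sigma_sets UNIV (Collect closed :: 'a set set)"
    by (subst borel_eq_closed) (simp add: sets_measure_of)
  show "Int_stable (Collect closed :: 'a set set)"
    by (auto simp: Int_stable_def)
next
  fix F :: "'a set" assume "F \<in> Collect closed"
  then have "(\<lambda>\<mu>. ennreal (measure \<mu> F)) \<in> borel_measurable weak_borel"
    by (intro measurable_compose[OF borel_measurable_weak_borel_closed measurable_ennreal]) simp
  then show "(\<lambda>\<mu>. emeasure \<mu> F) \<in> borel_measurable weak_borel"
    by (rule measurable_cong[THEN iffD1, rotated])
      (auto simp: prob_measures_def intro!: finite_measure.emeasure_eq_measure[symmetric] prob_space.finite_measure)
qed (auto simp: prob_measures_def)

definition empirical :: "nat \<Rightarrow> (nat \<Rightarrow> 'a::topological_space) \<Rightarrow> 'a measure" where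
  "empirical n z = distr (measure_pmf (pmf_of_set {1..n})) borel z"

lemma sets_empirical [simp, measurable_cong]: "sets (empirical n z) = sets borel"
  and space_empirical [simp]: "space (empirical n z) = UNIV"
  by (simp_all add: empirical_def)

lemma prob_space_empirical: "prob_space (empirical n z)"
  unfolding empirical_def by (rule measure_pmf.prob_space_distr) simp

lemma integral_empirical:
  fixes f :: "'a::topological_space \<Rightarrow> real"
  assumes "n \<ge> 1" "f \<in> borel_measurable borel"
  shows "(\<integral>x. f x \<partial>empirical n z) = (\<Sum>i=1..n. f (z i)) / n"
  using assms by (simp add: empirical_def integral_distr integral_pmf_of_set)

lemma empirical_cong:
  assumes "n \<ge> 1" "\<And>i. i \<in> {1..n} \<Longrightarrow> z i = z' i"
  shows "empirical n z = empirical n z'"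
  unfolding empirical_def using assms
  by (intro distr_cong_AE) (auto simp: AE_measure_pmf_iff)

text \<open>
  Integrating \<open>f\<close> against the empirical measure gives the average of the \<open>f (z i)\<close>, which is
  continuous in \<open>z\<close> for the product topology.
\<close>

lemma continuous_map_empirical:
  assumes "n \<ge> 1"
  shows "continuous_map euclidean weak_topology (empirical n :: (nat \<Rightarrow> 'a::topological_space) \<Rightarrow> _)"
  unfolding weak_topology_def
proof (rule continuous_on_generated_topo)
  fix V assume "V \<in> {{\<mu> \<in> prob_measures. (\<integral>x. f x \<partial>\<mu>) \<in> U} | (f :: 'a \<Rightarrow> real) U.
        continuous_on UNIV f \<and> bounded (range f) \<and> open U}"
  then obtain f :: "'a \<Rightarrow> real" and U where V: "V = {\<mu> \<in> prob_measures. (\<integral>x. f x \<partial>\<mu>) \<in> U}"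
    and f: "continuous_on UNIV f" and "open U"
    by blast
  have "(\<integral>x. f x \<partial>empirical n z) = (\<Sum>i=1..n. f (z i)) / n" for z
    using assms f by (intro integral_empirical borel_measurable_continuous_onI)
  then have eq: "empirical n -` V \<inter> topspace euclidean = (\<lambda>z. (\<Sum>i=1..n. f (z i)) / n) -` U"
    by (auto simp: V prob_measures_def prob_space_empirical)
  have "continuous_on UNIV (\<lambda>z :: nat \<Rightarrow> 'a. (\<Sum>i=1..n. f (z i)) / n)"
    using assms by (intro continuous_intros continuous_on_compose2[OF f]) auto
  then show "openin euclidean (empirical n -` V \<inter> topspace euclidean)"
    unfolding eq using \<open>open U\<close> by (simp add: open_vimage)
next
  show "empirical n ` topspace euclidean \<subseteq> \<Union> {{\<mu> \<in> prob_measures. (\<integral>x. f x \<partial>\<mu>) \<in> U} | (f :: 'a \<Rightarrow> real) U.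
        continuous_on UNIV f \<and> bounded (range f) \<and> open U}"
    using topspace_weak_topology[where ?'a='a]
    unfolding weak_topology_def topology_generated_by_topspace
    by (auto simp: prob_measures_def prob_space_empirical)
qed

text \<open>
  Because \<^const>\<open>weak_borel\<close> is generated by all weakly open sets, and not only by a
  subbasis, measurability is obtained from continuity: preimages of weakly open sets are open in
  \<open>nat \<Rightarrow> 'a\<close>, and in a second countable space such open sets belong to the product
  \<open>\<sigma>\<close>-algebra. A point of \<open>X^n\<close> is first padded to a function on all of \<open>nat\<close>.
\<close>

lemma empirical_measurable_weak_borel:
  assumes "n \<ge> 1"
  shows "empirical n \<in> borel_power n \<rightarrow>\<^sub>M (weak_borel :: 'a::second_countable_topology measure measure)"
proof -
  define c :: "(nat \<Rightarrow> 'a) \<Rightarrow> nat \<Rightarrow> 'a" where "c z i = (if i \<in> {1..n} then z i else undefined)" for z i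
  have "(\<lambda>z. c z i) \<in> borel_power n \<rightarrow>\<^sub>M borel" for i
  proof (cases "i \<in> {1..n}")
    case True
    then show ?thesis by (simp add: c_def)
  next
    case False
    then have "(\<lambda>z. c z i) = (\<lambda>_. undefined)"
      by (auto simp: c_def)
    then show ?thesis by simp
  qed
  then have "c \<in> borel_power n \<rightarrow>\<^sub>M PiM UNIV (\<lambda>_. borel)"
    by (intro measurable_PiM_single') auto
  then have c: "c \<in> borel_power n \<rightarrow>\<^sub>M borel"
    by (simp cong: measurable_cong_sets add: sets_PiM_equal_borel)
  have "empirical n \<in> borel \<rightarrow>\<^sub>M (weak_borel :: 'a measure measure)"
    unfolding weak_borel_def
  proof (rule measurable_measure_of)
    fix U :: "'a measure set" assume "U \<in> {U. openin weak_topology U}"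
    then have "openin euclidean {z \<in> topspace euclidean. empirical n z \<in> U}"
      using openin_continuous_map_preimage[OF continuous_map_empirical[OF assms]] by blast
    then show "empirical n -` U \<inter> space borel \<in> sets borel"
      by (simp add: vimage_def)
  next
    show "{U. openin weak_topology U} \<subseteq> Pow (prob_measures :: 'a measure set)"
      using openin_subset by fastforce
  qed (simp add: prob_measures_def prob_space_empirical)
  from measurable_comp[OF c this] show ?thesis
    by (rule measurable_cong[THEN iffD1, rotated])
      (auto simp: c_def intro!: empirical_cong assms)
qed

section \<open>Tilted measures and weighted products\<close>

text \<open>
  Finite products of probability kernels are again probability kernels, since the measure of a
  rectangle is a finite product of measurable functions.
\<close>

lemma PiM_measurable_prob_algebra:
  assumes I: "finite I" and K: "\<And>i. i \<in> I \<Longrightarrow> K i \<in> M \<rightarrow>\<^sub>M prob_algebra (N i)"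
  shows "(\<lambda>x. PiM I (\<lambda>i. K i x)) \<in> M \<rightarrow>\<^sub>M prob_algebra (PiM I N)"
proof (rule measurable_prob_algebra_generated[OF sets_PiM Int_stable_prod_algebra prod_algebra_sets_into_space])
  have prob: "prob_space (K i x)" and sets: "sets (K i x) = sets (N i)"
    if "i \<in> I" "x \<in> space M" for i x
    using measurable_space[OF K[OF that(1)] that(2)] by (auto simp: space_prob_algebra)
  fix x assume x: "x \<in> space M"
  show "prob_space (PiM I (\<lambda>i. K i x))"
    using prob x by (intro prob_space_PiM)
  show "sets (PiM I (\<lambda>i. K i x)) = sets (PiM I N)"
    using sets x by (intro sets_PiM_cong) auto
next
  have prob: "prob_space (K i x)" and sets: "sets (K i x) = sets (N i)"
    if "i \<in> I" "x \<in> space M" for i x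
    using measurable_space[OF K[OF that(1)] that(2)] by (auto simp: space_prob_algebra)
  fix A assume "A \<in> prod_algebra I N"
  then obtain X where A: "A = Pi\<^sub>E I X" and X: "\<And>i. i \<in> I \<Longrightarrow> X i \<in> sets (N i)"
    unfolding prod_algebra_eq_finite[OF I] by (auto simp: Pi_iff)
  have "(\<lambda>x. \<Prod>i\<in>I. emeasure (K i x) (X i)) \<in> borel_measurable M"
    using X measurable_prob_algebraD[OF K]
    by (intro borel_measurable_prod_ennreal measurable_emeasure_kernel) auto
  moreover have "emeasure (PiM I (\<lambda>i. K i x)) A = (\<Prod>i\<in>I. emeasure (K i x) (X i))" if "x \<in> space M" for x
  proof -
    have "prod_emb I (\<lambda>i. K i x) I (Pi\<^sub>E I X) = Pi\<^sub>E I X"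
      using sets.sets_into_space[OF X] sets_eq_imp_space_eq[OF sets[OF _ that]] by (intro prod_emb_id PiE_mono) auto
    then show ?thesis
      using emeasure_PiM_emb[of I "\<lambda>i. K i x" I X] prob sets X that I A by simp
  qed
  ultimately show "(\<lambda>x. emeasure (PiM I (\<lambda>i. K i x)) A) \<in> borel_measurable M"
    by (simp cong: measurable_cong)
qed

text \<open>
  Only the densities indexed by \<open>I\<close> are constrained, so both sides are compared on cylinder sets,
  where the right-hand side factorises by Fubini.
\<close>

lemma PiM_density:
  fixes g :: "'i \<Rightarrow> 'a \<Rightarrow> ennreal"
  assumes I: "finite I" and "prob_space \<mu>"
    and g: "\<And>i. i \<in> I \<Longrightarrow> g i \<in> borel_measurable \<mu>"
    and prob: "\<And>i. i \<in> I \<Longrightarrow> prob_space (density \<mu> (g i))"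
  shows "PiM I (\<lambda>i. density \<mu> (g i)) = density (PiM I (\<lambda>_. \<mu>)) (\<lambda>x. \<Prod>i\<in>I. g i (x i))"
    (is "?L = ?R")
proof (rule measure_eqI_PiM_infinite[of _ I "\<lambda>_. \<mu>"])
  interpret prob_space \<mu> by fact
  interpret product_sigma_finite "\<lambda>_. \<mu>" by standard
  show "sets ?L = PiM I (\<lambda>_. \<mu>)" by (intro sets_PiM_cong) auto
  show "sets ?R = PiM I (\<lambda>_. \<mu>)" by simp
  interpret L: prob_space ?L using prob by (rule prob_space_PiM)
  show "finite_measure ?L" by unfold_locales
  fix J A assume "finite J" "J \<subseteq> I" and A: "\<And>j. j \<in> J \<Longrightarrow> A j \<in> sets \<mu>"
  define B where "B j = (if j \<in> J then A j else space \<mu>)" for j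
  have B: "B i \<in> sets \<mu>" if "i \<in> I" for i
    using that A by (auto simp: B_def)
  have E: "prod_emb I (\<lambda>_. \<mu>) J (Pi\<^sub>E J A) = Pi\<^sub>E I B"
    using \<open>J \<subseteq> I\<close> sets.sets_into_space[OF A]
    by (auto simp: prod_emb_def PiE_def Pi_def B_def extensional_def restrict_def)
  have BI: "Pi\<^sub>E I B \<in> sets (PiM I (\<lambda>_. \<mu>))"
    using B I by (intro sets_PiM_I_finite) auto
  have gm: "(\<lambda>x. \<Prod>i\<in>I. g i (x i)) \<in> borel_measurable (PiM I (\<lambda>_. \<mu>))"
    using g by (intro borel_measurable_prod_ennreal) (auto intro: measurable_compose[OF measurable_component_singleton])
  have "prod_emb I (\<lambda>i. density \<mu> (g i)) I (Pi\<^sub>E I B) = Pi\<^sub>E I B"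
    using sets.sets_into_space[OF B] by (intro prod_emb_id) auto
  then have "emeasure ?L (Pi\<^sub>E I B) = (\<Prod>i\<in>I. emeasure (density \<mu> (g i)) (B i))"
    using emeasure_PiM_emb[of I "\<lambda>i. density \<mu> (g i)" I B] prob B I by simp
  also have "\<dots> = (\<Prod>i\<in>I. \<integral>\<^sup>+x. g i x * indicator (B i) x \<partial>\<mu>)"
    using g B by (intro prod.cong) (auto simp: emeasure_density)
  also have "\<dots> = (\<integral>\<^sup>+x. (\<Prod>i\<in>I. g i (x i) * indicator (B i) (x i)) \<partial>PiM I (\<lambda>_. \<mu>))"
    using g B I by (intro product_nn_integral_prod[symmetric]) auto
  also have "\<dots> = (\<integral>\<^sup>+x. (\<Prod>i\<in>I. g i (x i)) * indicator (Pi\<^sub>E I B) x \<partial>PiM I (\<lambda>_. \<mu>))"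
  proof (rule nn_integral_cong)
    fix x assume x: "x \<in> space (PiM I (\<lambda>_. \<mu>))"
    have "(\<Prod>i\<in>I. indicator (B i) (x i)) = (indicator (Pi\<^sub>E I B) x :: ennreal)"
    proof (cases "\<forall>i\<in>I. x i \<in> B i")
      case True
      with x show ?thesis by (auto simp: space_PiM PiE_def Pi_def)
    next
      case False
      then obtain i where "i \<in> I" "x i \<notin> B i" by blast
      then have "x \<notin> Pi\<^sub>E I B" "indicator (B i) (x i) = (0::ennreal)" by auto
      with \<open>i \<in> I\<close> I show ?thesis by (subst prod_zero) auto
    qed
    then show "(\<Prod>i\<in>I. g i (x i) * indicator (B i) (x i)) = (\<Prod>i\<in>I. g i (x i)) * indicator (Pi\<^sub>E I B) x"
      by (simp add: prod.distrib)
  qed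
  also have "\<dots> = emeasure ?R (Pi\<^sub>E I B)"
    using gm BI by (simp add: emeasure_density)
  finally show "emeasure ?L (prod_emb I (\<lambda>_. \<mu>) J (Pi\<^sub>E J A)) = emeasure ?R (prod_emb I (\<lambda>_. \<mu>) J (Pi\<^sub>E J A))"
    by (simp only: E)
qed

text \<open>
  The positive lower bound keeps the normalising constants of tilts away from zero, uniformly over
  all probability measures; the upper bound keeps them finite.
\<close>

definition bounded_weight :: "'a measure \<Rightarrow> ('a \<Rightarrow> real) \<Rightarrow> bool" where
  "bounded_weight M f \<longleftrightarrow> f \<in> borel_measurable M \<and> (\<exists>a b. 0 < a \<and> (\<forall>x\<in>space M. a \<le> f x \<and> f x \<le> b))"

lemma bounded_weight_measurable: "bounded_weight M f \<Longrightarrow> f \<in> borel_measurable M"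
  by (simp add: bounded_weight_def)

lemma bounded_weight_pos: "bounded_weight M f \<Longrightarrow> x \<in> space M \<Longrightarrow> 0 < f x"
  by (auto simp: bounded_weight_def intro: less_le_trans)

lemma bounded_weight_cong_sets:
  assumes "sets M = sets N"
  shows "bounded_weight M f \<longleftrightarrow> bounded_weight N f"
  using assms sets_eq_imp_space_eq[OF assms]
  by (simp add: bounded_weight_def cong: measurable_cong_sets)

lemma bounded_weight_prod:
  assumes "\<And>i. i \<in> I \<Longrightarrow> bounded_weight M (f i)"
  shows "bounded_weight M (\<lambda>x. \<Prod>i\<in>I. f i x)"
proof -
  have "\<forall>i\<in>I. \<exists>a b. 0 < a \<and> (\<forall>x\<in>space M. a \<le> f i x \<and> f i x \<le> b)"
    using assms by (simp add: bounded_weight_def)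
  then obtain a b where ab: "\<And>i. i \<in> I \<Longrightarrow> 0 < a i"
    "\<And>i x. i \<in> I \<Longrightarrow> x \<in> space M \<Longrightarrow> a i \<le> f i x \<and> f i x \<le> b i"
    by metis
  have "(\<Prod>i\<in>I. a i) \<le> (\<Prod>i\<in>I. f i x) \<and> (\<Prod>i\<in>I. f i x) \<le> (\<Prod>i\<in>I. b i)" if "x \<in> space M" for x
    using ab that by (intro conjI prod_mono) (auto simp: less_imp_le intro: order_trans[OF less_imp_le])
  moreover have "0 < (\<Prod>i\<in>I. a i)"
    using ab by (intro prod_pos) auto
  ultimately show ?thesis
    using assms unfolding bounded_weight_def by (intro conjI borel_measurable_prod) blast+
qed

context prob_space
begin

lemma bounded_weight_integrable:
  assumes f: "bounded_weight M f"
  shows "integrable M f"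
proof -
  obtain a b where ab: "0 < a" "\<And>x. x \<in> space M \<Longrightarrow> a \<le> f x" "\<And>x. x \<in> space M \<Longrightarrow> f x \<le> b"
    using f by (auto simp: bounded_weight_def)
  have "\<bar>f x\<bar> \<le> b" if "x \<in> space M" for x
    using ab(1) ab(2)[OF that] ab(3)[OF that] by linarith
  then show ?thesis
    using bounded_weight_measurable[OF f] by (intro integrable_const_bound[of _ b]) auto
qed

lemma bounded_weight_integral_pos:
  assumes f: "bounded_weight M f"
  shows "0 < (\<integral>x. f x \<partial>M)"
proof -
  obtain a where a: "0 < a" "\<And>x. x \<in> space M \<Longrightarrow> a \<le> f x"
    using f by (auto simp: bounded_weight_def)
  have "a \<le> (\<integral>x. f x \<partial>M)"
    using a bounded_weight_integrable[OF assms] by (intro integral_ge_const) auto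
  with a show ?thesis by simp
qed

lemma bounded_weight_nn_integral:
  assumes f: "bounded_weight M f"
  shows "(\<integral>\<^sup>+x. ennreal (f x) \<partial>M) = ennreal (\<integral>x. f x \<partial>M)"
  using bounded_weight_integrable[OF f] bounded_weight_pos[OF f]
  by (intro nn_integral_eq_integral) (auto simp: less_imp_le)

lemma emeasure_tilt:
  assumes f: "bounded_weight M f" and A: "A \<in> sets M"
  shows "emeasure (tilt f M) A = (\<integral>\<^sup>+x. ennreal (f x) * indicator A x \<partial>M) / ennreal (\<integral>x. f x \<partial>M)"
proof -
  define c where "c = (\<integral>x. f x \<partial>M)"
  have c: "c > 0" unfolding c_def using f by (rule bounded_weight_integral_pos)
  have [measurable]: "f \<in> borel_measurable M" "A \<in> sets M"
    using f A by (auto simp: bounded_weight_def)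
  have "emeasure (tilt f M) A = (\<integral>\<^sup>+x. ennreal (f x) * indicator A x / ennreal c \<partial>M)"
    unfolding tilt_def c_def[symmetric]
    using c bounded_weight_pos[OF f]
    by (subst emeasure_density)
      (auto intro!: nn_integral_cong simp: divide_ennreal[symmetric] less_imp_le split: split_indicator)
  then show ?thesis
    by (simp add: nn_integral_divide c_def)
qed

lemma prob_space_tilt:
  assumes f: "bounded_weight M f"
  shows "prob_space (tilt f M)"
proof
  have "emeasure (tilt f M) (space M) = (\<integral>\<^sup>+x. ennreal (f x) \<partial>M) / ennreal (\<integral>x. f x \<partial>M)"
    by (subst emeasure_tilt[OF f]) (auto intro!: arg_cong2[of _ _ _ _ "(/)"] nn_integral_cong)
  also have "\<dots> = 1"
    using bounded_weight_integral_pos[OF f] bounded_weight_nn_integral[OF f] by (simp add: ennreal_divide_self)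
  finally show "emeasure (tilt f M) (space (tilt f M)) = 1" by (simp add: tilt_def)
qed

lemma measure_tilt:
  assumes f: "bounded_weight M f" and A: "A \<in> sets M"
  shows "measure (tilt f M) A = (\<integral>x. f x * indicator A x \<partial>M) / (\<integral>x. f x \<partial>M)"
proof -
  note [measurable] = bounded_weight_measurable[OF f] A
  have "integrable M (\<lambda>x. f x * indicator A x)"
    using bounded_weight_integrable[OF f] A by (rule integrable_real_mult_indicator[rotated])
  moreover have "AE x in M. 0 \<le> f x * indicator A x"
    using bounded_weight_pos[OF f] by (auto simp: less_imp_le)
  ultimately have "(\<integral>\<^sup>+x. ennreal (f x * indicator A x) \<partial>M) = ennreal (\<integral>x. f x * indicator A x \<partial>M)"
    by (rule nn_integral_eq_integral)
  moreover have "(\<integral>\<^sup>+x. ennreal (f x * indicator A x) \<partial>M) = (\<integral>\<^sup>+x. ennreal (f x) * indicator A x \<partial>M)"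
    by (intro nn_integral_cong) (auto split: split_indicator)
  moreover have "0 \<le> (\<integral>x. f x * indicator A x \<partial>M)"
    using bounded_weight_pos[OF f] by (intro integral_nonneg_AE) (auto simp: less_imp_le)
  ultimately have "emeasure (tilt f M) A = ennreal ((\<integral>x. f x * indicator A x \<partial>M) / (\<integral>x. f x \<partial>M))"
    using emeasure_tilt[OF f A] bounded_weight_integral_pos[OF f] by (simp add: divide_ennreal)
  then show ?thesis
    using \<open>0 \<le> (\<integral>x. f x * indicator A x \<partial>M)\<close> bounded_weight_integral_pos[OF f] by (simp add: measure_def)
qed

end

lemma sets_tilt [simp, measurable_cong]: "sets (tilt f M) = sets M"
  and space_tilt [simp]: "space (tilt f M) = space M"
  by (simp_all add: tilt_def)

text \<open>
  By \<open>emeasure_tilt\<close>, the tilted mass of a set is a quotient of two integrals against the measure,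
  each of which is a measurable function of it.
\<close>

lemma tilt_measurable_prob_algebra:
  assumes f: "bounded_weight N f"
  shows "tilt f \<in> prob_algebra N \<rightarrow>\<^sub>M prob_algebra N"
proof (rule measurable_prob_algebra_generated)
  show "sets N = sigma_sets (space N) (sets N)"
    by (simp add: sets.sigma_sets_eq)
  show "Int_stable (sets N)" by (auto simp: Int_stable_def)
  show "sets N \<subseteq> Pow (space N)" by (rule sets.space_closed)
next
  fix \<mu> assume "\<mu> \<in> space (prob_algebra N)"
  then have s: "sets \<mu> = sets N" and "prob_space \<mu>" by (auto simp: space_prob_algebra)
  then show "prob_space (tilt f \<mu>)"
    using f by (intro prob_space.prob_space_tilt) (simp_all cong: bounded_weight_cong_sets)
  show "sets (tilt f \<mu>) = sets N" using s by simp
next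
  fix A assume A: "A \<in> sets N"
  have [measurable]: "f \<in> borel_measurable N" using f by (rule bounded_weight_measurable)
  have id: "(\<lambda>\<mu>. \<mu>) \<in> prob_algebra N \<rightarrow>\<^sub>M subprob_algebra N"
    by (intro measurable_prob_algebraD measurable_ident_sets) simp
  have "(\<lambda>\<mu>. \<integral>\<^sup>+x. ennreal (f x) * indicator A x \<partial>\<mu>) \<in> borel_measurable (prob_algebra N)"
    using A by (intro measurable_compose[OF id nn_integral_measurable_subprob_algebra]) auto
  moreover have "(\<lambda>\<mu>. \<integral>\<^sup>+x. ennreal (f x) \<partial>\<mu>) \<in> borel_measurable (prob_algebra N)"
    by (intro measurable_compose[OF id nn_integral_measurable_subprob_algebra]) auto
  ultimately have "(\<lambda>\<mu>. (\<integral>\<^sup>+x. ennreal (f x) * indicator A x \<partial>\<mu>) / (\<integral>\<^sup>+x. ennreal (f x) \<partial>\<mu>))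
      \<in> borel_measurable (prob_algebra N)"
    by (rule borel_measurable_divide_ennreal)
  then show "(\<lambda>\<mu>. emeasure (tilt f \<mu>) A) \<in> borel_measurable (prob_algebra N)"
  proof (rule measurable_cong[THEN iffD1, rotated])
    fix \<mu> assume "\<mu> \<in> space (prob_algebra N)"
    then have s: "sets \<mu> = sets N" and "prob_space \<mu>" by (auto simp: space_prob_algebra)
    moreover have "bounded_weight \<mu> f" using f s by (simp cong: bounded_weight_cong_sets)
    ultimately show "(\<integral>\<^sup>+x. ennreal (f x) * indicator A x \<partial>\<mu>) / (\<integral>\<^sup>+x. ennreal (f x) \<partial>\<mu>) = emeasure (tilt f \<mu>) A"
      using A by (simp add: prob_space.emeasure_tilt prob_space.bounded_weight_nn_integral)
  qed
qed

lemma bounded_weight_prob_measures: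
  "bounded_weight borel f \<Longrightarrow> \<mu> \<in> prob_measures \<Longrightarrow> bounded_weight \<mu> f"
  using bounded_weight_cong_sets[of \<mu> borel f] by (auto simp: prob_measures_def)

lemma weighted_iid_measurable:
  assumes "\<And>i. i \<in> {1..n} \<Longrightarrow> bounded_weight borel (l i)"
  shows "weighted_iid n l \<in> prob_algebra borel \<rightarrow>\<^sub>M prob_algebra (borel_power n)"
  unfolding weighted_iid_def
  using assms by (intro PiM_measurable_prob_algebra tilt_measurable_prob_algebra) auto

lemma restrict_weighted_iid:
  assumes "\<And>i. i \<in> {1..n} \<Longrightarrow> bounded_weight borel (l i)" "\<mu> \<in> prob_measures" "k \<le> n"
  shows "distr (weighted_iid n l \<mu>) (borel_power k) (\<lambda>x. restrict x {1..k}) = weighted_iid k l \<mu>"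
proof -
  have "sets (weighted_iid k l \<mu>) = sets (borel_power k)"
    unfolding weighted_iid_def using assms(2) by (intro sets_PiM_cong) (auto simp: tilt_def prob_measures_def)
  then have "distr (weighted_iid n l \<mu>) (borel_power k) (\<lambda>x. restrict x {1..k}) =
      distr (PiM {1..n} (\<lambda>i. tilt (l i) \<mu>)) (PiM {1..k} (\<lambda>i. tilt (l i) \<mu>)) (\<lambda>x. \<lambda>i\<in>{1..k}. x i)"
    by (intro distr_cong) (auto simp: weighted_iid_def)
  also have "\<dots> = weighted_iid k l \<mu>"
    unfolding weighted_iid_def
  proof (rule distr_PiM_reindex[where f = "\<lambda>i. i"])
    show "prob_space (tilt (l i) \<mu>)" if "i \<in> {1..n}" for i
      using bounded_weight_prob_measures[OF assms(1)[OF that] assms(2)] assms(2)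
      by (auto simp: prob_measures_def intro: prob_space.prob_space_tilt)
  qed (use assms(3) in auto)
  finally show ?thesis .
qed

text \<open>
  Multiplying by the normalising constants turns the weighted product into the plain product
  measure with density \<open>\<Prod>i. l i (x i)\<close>. Unlike the normalised version, this expression is linear
  in the \<open>k\<close>-fold product of \<open>\<mu>\<close>, so it commutes with mixing over \<open>\<mu>\<close>.
\<close>

lemma weighted_iid_unnormalized:
  assumes l: "\<And>i. i \<in> {1..k} \<Longrightarrow> bounded_weight borel (l i)" and \<mu>: "\<mu> \<in> prob_measures"
    and A: "A \<in> sets (borel_power k)"
  shows "ennreal (\<Prod>i=1..k. \<integral>x. l i x \<partial>\<mu>) * emeasure (weighted_iid k l \<mu>) A =
    (\<integral>\<^sup>+x. ennreal (\<Prod>i=1..k. l i (x i)) * indicator A x \<partial>PiM {1..k} (\<lambda>_. \<mu>))"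
proof -
  from \<mu> have s: "sets \<mu> = sets borel" and "prob_space \<mu>" by (auto simp: prob_measures_def)
  have l': "bounded_weight \<mu> (l i)" if "i \<in> {1..k}" for i
    using l[OF that] \<mu> by (rule bounded_weight_prob_measures)
  interpret prob_space \<mu> by fact
  define c where "c i = (\<integral>x. l i x \<partial>\<mu>)" for i
  have c: "c i > 0" if "i \<in> {1..k}" for i
    unfolding c_def using l'[OF that] by (rule bounded_weight_integral_pos)
  have lm: "l i \<in> borel_measurable \<mu>" if "i \<in> {1..k}" for i
    using l'[OF that] by (rule bounded_weight_measurable)
  have sP: "sets (PiM {1..k} (\<lambda>_. \<mu>)) = sets (borel_power k)"
    using s by (intro sets_PiM_cong) auto
  have gm: "(\<lambda>x. \<Prod>i=1..k. ennreal (l i (x i) / c i)) \<in> borel_measurable (PiM {1..k} (\<lambda>_. \<mu>))"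
    using lm by (intro borel_measurable_prod_ennreal measurable_compose[OF _ measurable_ennreal]
        borel_measurable_divide borel_measurable_const measurable_compose[OF measurable_component_singleton]) auto
  have "weighted_iid k l \<mu> = density (PiM {1..k} (\<lambda>_. \<mu>)) (\<lambda>x. \<Prod>i=1..k. ennreal (l i (x i) / c i))"
    unfolding weighted_iid_def tilt_def c_def[symmetric]
    using lm prob_space_tilt[OF l'] \<open>prob_space \<mu>\<close>
    by (intro PiM_density) (auto simp: tilt_def c_def)
  then have "emeasure (weighted_iid k l \<mu>) A =
      (\<integral>\<^sup>+x. (\<Prod>i=1..k. ennreal (l i (x i) / c i)) * indicator A x \<partial>PiM {1..k} (\<lambda>_. \<mu>))"
    using gm A sP by (simp add: emeasure_density)
  then have "ennreal (\<Prod>i=1..k. c i) * emeasure (weighted_iid k l \<mu>) A =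
      (\<integral>\<^sup>+x. ennreal (\<Prod>i=1..k. c i) * ((\<Prod>i=1..k. ennreal (l i (x i) / c i)) * indicator A x) \<partial>PiM {1..k} (\<lambda>_. \<mu>))"
    using gm A sP by (subst nn_integral_cmult)
      (auto intro!: borel_measurable_times_ennreal borel_measurable_indicator)
  also have "\<dots> = (\<integral>\<^sup>+x. ennreal (\<Prod>i=1..k. l i (x i)) * indicator A x \<partial>PiM {1..k} (\<lambda>_. \<mu>))"
  proof (rule nn_integral_cong)
    fix x :: "nat \<Rightarrow> 'a"
    have "(\<Prod>i=1..k. ennreal (l i (x i) / c i)) = ennreal (\<Prod>i=1..k. l i (x i) / c i)"
      using c bounded_weight_pos[OF l] by (intro prod_ennreal) (auto simp: less_imp_le)
    moreover have "(\<Prod>i=1..k. c i) * (\<Prod>i=1..k. l i (x i) / c i) = (\<Prod>i=1..k. l i (x i))"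
      unfolding prod.distrib[symmetric] using c by (intro prod.cong) (auto simp: less_imp_neq[symmetric])
    moreover have "0 \<le> (\<Prod>i=1..k. c i)"
      using c by (intro prod_nonneg) (auto simp: less_imp_le)
    ultimately show "ennreal (\<Prod>i=1..k. c i) * ((\<Prod>i=1..k. ennreal (l i (x i) / c i)) * indicator A x) =
        ennreal (\<Prod>i=1..k. l i (x i)) * indicator A x"
      by (simp add: mult.assoc[symmetric] ennreal_mult'[symmetric])
  qed
  finally show ?thesis by (simp add: c_def)
qed

section \<open>Total variation under tilting\<close>

text \<open>
  If the odds of \<open>s\<close> exceed those of \<open>t\<close> by a factor of at most \<open>r\<^sup>2\<close>, the difference is largest
  for \<open>s = r / (r + 1)\<close> and \<open>t = 1 / (r + 1)\<close>. With \<open>u = sqrt (s * (1 - t))\<close> and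
  \<open>v = sqrt (t * (1 - s))\<close> one has \<open>s - t = (u - v) * (u + v)\<close>, the hypothesis says \<open>u \<le> r * v\<close>, and
  \<open>u + v \<le> 1\<close> by the inequality of arithmetic and geometric means.
\<close>

lemma diff_le_of_odds_ratio_le:
  fixes s t r :: real
  assumes "0 \<le> s" "s \<le> 1" "0 \<le> t" "t \<le> 1" "1 \<le> r"
    and odds: "s * (1 - t) \<le> r\<^sup>2 * (t * (1 - s))"
  shows "s - t \<le> (r - 1) / (r + 1)"
proof -
  define u v where "u = sqrt (s * (1 - t))" and "v = sqrt (t * (1 - s))"
  have uv: "0 \<le> u" "0 \<le> v" "u\<^sup>2 = s * (1 - t)" "v\<^sup>2 = t * (1 - s)"
    using assms by (simp_all add: u_def v_def)
  have "u \<le> r * v"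
    using real_sqrt_le_mono[OF odds] assms(5) by (simp add: u_def v_def real_sqrt_mult)
  have "u \<le> (s + (1 - t)) / 2" "v \<le> (t + (1 - s)) / 2"
    unfolding u_def v_def using assms by (intro arith_geo_mean_sqrt; simp)+
  then have "u + v \<le> 1" by (simp add: field_simps)
  have "(u - v) * (r + 1) \<le> (r - 1) * (u + v)"
    using \<open>u \<le> r * v\<close> by (simp add: algebra_simps)
  then have "u - v \<le> (r - 1) / (r + 1) * (u + v)"
    using assms(5) by (simp add: field_simps)
  have "s - t = (u - v) * (u + v)"
    using uv by (simp add: algebra_simps power2_eq_square)
  also have "\<dots> \<le> (r - 1) / (r + 1) * (u + v) * (u + v)"
    using \<open>u - v \<le> _\<close> uv by (intro mult_right_mono) auto
  also have "\<dots> = (r - 1) / (r + 1) * (u + v)\<^sup>2"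
    by (simp add: power2_eq_square)
  also have "\<dots> \<le> (r - 1) / (r + 1) * 1"
    using assms(5) uv \<open>u + v \<le> 1\<close> by (intro mult_left_mono power_le_one) auto
  finally show ?thesis by simp
qed

lemma (in prob_space) measure_density_between:
  assumes h: "h \<in> borel_measurable M" and ab: "0 < a" "\<And>x. x \<in> space M \<Longrightarrow> a \<le> h x \<and> h x \<le> b"
    and prob: "prob_space (density M (\<lambda>x. ennreal (h x)))" and A: "A \<in> sets M"
  shows "a * measure M A \<le> measure (density M (\<lambda>x. ennreal (h x))) A"
    and "measure (density M (\<lambda>x. ennreal (h x))) A \<le> b * measure M A"
proof -
  interpret D: prob_space "density M (\<lambda>x. ennreal (h x))" by fact
  obtain x0 where "x0 \<in> space M" using not_empty by blast
  with ab have "0 < b" using ab(2)[of x0] by linarith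
  have e: "emeasure (density M (\<lambda>x. ennreal (h x))) A = (\<integral>\<^sup>+x. ennreal (h x) * indicator A x \<partial>M)"
    using h A by (simp add: emeasure_density)
  have "ennreal a * emeasure M A = (\<integral>\<^sup>+x. ennreal a * indicator A x \<partial>M)"
    using A by (simp add: nn_integral_cmult)
  also have "\<dots> \<le> emeasure (density M (\<lambda>x. ennreal (h x))) A"
    unfolding e using ab by (intro nn_integral_mono mult_right_mono ennreal_leI) auto
  finally show "a * measure M A \<le> measure (density M (\<lambda>x. ennreal (h x))) A"
    using ab(1) by (simp add: emeasure_eq_measure D.emeasure_eq_measure ennreal_mult'[symmetric])
  have "emeasure (density M (\<lambda>x. ennreal (h x))) A \<le> (\<integral>\<^sup>+x. ennreal b * indicator A x \<partial>M)"
    unfolding e using ab by (intro nn_integral_mono mult_right_mono ennreal_leI) auto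
  also have "\<dots> = ennreal b * emeasure M A"
    using A by (simp add: nn_integral_cmult)
  finally show "measure (density M (\<lambda>x. ennreal (h x))) A \<le> b * measure M A"
    using \<open>0 < b\<close> by (simp add: emeasure_eq_measure D.emeasure_eq_measure ennreal_mult'[symmetric])
qed

text \<open>
  A density with values in \<open>{a..b}\<close> changes the odds of every event by a factor of at most
  \<open>b / a\<close>, so \<open>diff_le_of_odds_ratio_le\<close> applies with \<open>r = sqrt (b / a)\<close>.
\<close>

lemma (in prob_space) measure_diff_density_le:
  assumes h: "h \<in> borel_measurable M" and ab: "0 < a" "\<And>x. x \<in> space M \<Longrightarrow> a \<le> h x \<and> h x \<le> b"
    and prob: "prob_space (density M (\<lambda>x. ennreal (h x)))" and A: "A \<in> sets M"
  shows "\<bar>measure (density M (\<lambda>x. ennreal (h x))) A - measure M A\<bar> \<le> (sqrt (b / a) - 1) / (sqrt (b / a) + 1)"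
proof -
  interpret D: prob_space "density M (\<lambda>x. ennreal (h x))" by fact
  have "a \<le> b" using ab(2) not_empty by fastforce
  have le: "D.prob B - prob B \<le> (sqrt (b / a) - 1) / (sqrt (b / a) + 1)" if B: "B \<in> sets M" for B
  proof (rule diff_le_of_odds_ratio_le)
    have "B \<in> D.events" "space M - B \<in> sets M" using B by auto
    then have c: "D.prob (space M - B) = 1 - D.prob B" "prob (space M - B) = 1 - prob B"
      using D.prob_compl[of B] prob_compl[of B] by auto
    have "a * (1 - prob B) \<le> 1 - D.prob B" "D.prob B \<le> b * prob B"
      using measure_density_between[OF h ab prob, of B] B
        measure_density_between[OF h ab prob, of "space M - B"] c by auto
    have "a * (D.prob B * (1 - prob B)) = D.prob B * (a * (1 - prob B))"
      by simp
    also have "\<dots> \<le> (b * prob B) * (1 - D.prob B)"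
      using \<open>a * (1 - prob B) \<le> 1 - D.prob B\<close> \<open>D.prob B \<le> b * prob B\<close> ab(1) D.prob_le_1[of B] \<open>a \<le> b\<close>
      by (intro mult_mono) auto
    finally show "D.prob B * (1 - prob B) \<le> (sqrt (b / a))\<^sup>2 * (prob B * (1 - D.prob B))"
      using ab(1) \<open>a \<le> b\<close> by (simp add: field_simps)
  qed (use \<open>a \<le> b\<close> ab(1) in auto)
  have "space M - A \<in> sets M" "A \<in> D.events" using A by auto
  then have "prob A - D.prob A = D.prob (space M - A) - prob (space M - A)"
    using D.prob_compl[of A] prob_compl[of A] A by auto
  with le[OF A] le[OF \<open>space M - A \<in> sets M\<close>] show ?thesis by linarith
qed

lemma integral_mono_scaled_measure:
  fixes f :: "'a \<Rightarrow> real"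
  assumes p: "prob_space p" and q: "prob_space q" and sets: "sets p = sets q"
    and "0 \<le> \<beta>" and le: "\<And>A. A \<in> sets p \<Longrightarrow> \<beta> * measure p A \<le> measure q A"
    and f: "f \<in> borel_measurable p" "\<And>x. x \<in> space p \<Longrightarrow> 0 \<le> f x \<and> f x \<le> b"
  shows "\<beta> * (\<integral>x. f x \<partial>p) \<le> (\<integral>x. f x \<partial>q)"
proof -
  interpret p: prob_space p by fact
  interpret q: prob_space q by fact
  have sp: "space p = space q" using sets by (rule sets_eq_imp_space_eq)
  have fq: "f \<in> borel_measurable q" using f(1) sets by (simp cong: measurable_cong_sets)
  have "integrable p f" "integrable q f"
    using f fq sp by (auto intro!: p.integrable_const_bound[of _ b] q.integrable_const_bound[of _ b])
  then have P: "(\<integral>\<^sup>+x. ennreal (f x) \<partial>p) = ennreal (\<integral>x. f x \<partial>p)"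
    and Q: "(\<integral>\<^sup>+x. ennreal (f x) \<partial>q) = ennreal (\<integral>x. f x \<partial>q)"
    using f sp by (auto intro!: nn_integral_eq_integral)
  have "scale_measure (ennreal \<beta>) p \<le> q"
    using le sets \<open>0 \<le> \<beta>\<close>
    by (subst le_measure)
      (auto simp: p.emeasure_eq_measure q.emeasure_eq_measure ennreal_mult'[symmetric] intro!: ennreal_leI)
  then have "(\<integral>\<^sup>+x. ennreal (f x) \<partial>scale_measure (ennreal \<beta>) p) \<le> (\<integral>\<^sup>+x. ennreal (f x) \<partial>q)"
    using sets by (intro nn_integral_mono_measure) auto
  then have "ennreal \<beta> * ennreal (\<integral>x. f x \<partial>p) \<le> ennreal (\<integral>x. f x \<partial>q)"
    using f by (simp add: nn_integral_scale_measure P Q)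
  moreover have "0 \<le> (\<integral>x. f x \<partial>q)" using f sp by (intro integral_nonneg_AE) auto
  ultimately show ?thesis using \<open>0 \<le> \<beta>\<close> by (simp add: ennreal_mult'[symmetric])
qed

text \<open>
  Write \<open>F\<close> and \<open>G\<close> for the two normalising constants. Since \<open>\<beta> p \<le> q\<close>, the unnormalised tilts
  satisfy \<open>\<beta> F (tilt f p) \<le> G (tilt f q)\<close>, hence
  \<open>tilt f p A - tilt f q A \<le> (G - \<beta> F) / G\<close>. The numerator is the integral of \<open>f\<close> against the positive
  measure \<open>q - \<beta> p\<close> of mass \<open>1 - \<beta>\<close>, at most \<open>(1 - \<beta>) b\<close>, and the denominator is at least \<open>a\<close>.
  Complements give the other sign.
\<close>

lemma measure_diff_tilt_le:
  fixes f :: "'a \<Rightarrow> real"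
  assumes p: "prob_space p" and q: "prob_space q" and sets: "sets p = sets q"
    and \<beta>: "0 \<le> \<beta>" "\<beta> \<le> 1" and le: "\<And>A. A \<in> sets p \<Longrightarrow> \<beta> * measure p A \<le> measure q A"
    and f: "f \<in> borel_measurable p" and ab: "0 < a" "\<And>x. x \<in> space p \<Longrightarrow> a \<le> f x \<and> f x \<le> b"
    and A: "A \<in> sets p"
  shows "\<bar>measure (tilt f p) A - measure (tilt f q) A\<bar> \<le> (1 - \<beta>) * (b / a)"
proof -
  interpret p: prob_space p by fact
  interpret q: prob_space q by fact
  have sp: "space p = space q" using sets by (rule sets_eq_imp_space_eq)
  have fp: "bounded_weight p f" using f ab by (auto simp: bounded_weight_def)
  then have fq: "bounded_weight q f" by (simp add: bounded_weight_cong_sets[OF sets])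
  interpret tp: prob_space "tilt f p" by (rule p.prob_space_tilt[OF fp])
  interpret tq: prob_space "tilt f q" by (rule q.prob_space_tilt[OF fq])
  define F G where "F = (\<integral>x. f x \<partial>p)" and "G = (\<integral>x. f x \<partial>q)"
  have F: "F > 0" unfolding F_def by (rule p.bounded_weight_integral_pos[OF fp])
  have "a \<le> b" using ab(2) p.not_empty by fastforce
  have G: "a \<le> G"
    unfolding G_def using ab sp q.bounded_weight_integrable[OF fq] by (intro q.integral_ge_const) auto
  \<comment> \<open>Domination is applied to the nonnegative function \<open>b - f\<close>, so that the masses of \<open>p\<close> and \<open>q\<close> enter.\<close>
  have "\<beta> * (\<integral>x. b - f x \<partial>p) \<le> (\<integral>x. b - f x \<partial>q)"
    using f ab(1) by (intro integral_mono_scaled_measure[OF p q sets \<beta>(1) le, where b = b])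
      (auto dest!: ab(2))
  then have "\<beta> * (b - F) \<le> b - G"
    using p.bounded_weight_integrable[OF fp] q.bounded_weight_integrable[OF fq]
    by (simp add: F_def G_def p.prob_space q.prob_space)
  then have "G - \<beta> * F \<le> (1 - \<beta>) * b" by (simp add: algebra_simps)
  have diff: "tp.prob B - tq.prob B \<le> (1 - \<beta>) * (b / a)" if B: "B \<in> sets p" for B
  proof -
    have "\<beta> * (\<integral>x. f x * indicator B x \<partial>p) \<le> (\<integral>x. f x * indicator B x \<partial>q)"
      using f ab(1) \<open>a \<le> b\<close> B by (intro integral_mono_scaled_measure[OF p q sets \<beta>(1) le, where b = b])
        (auto dest!: ab(2) split: split_indicator)
    then have "\<beta> * (F * tp.prob B) \<le> G * tq.prob B"
      using F G ab(1) B sets p.measure_tilt[OF fp B] q.measure_tilt[OF fq, of B]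
      by (simp add: F_def[symmetric] G_def[symmetric])
    then have "G * (tp.prob B - tq.prob B) \<le> (G - \<beta> * F) * tp.prob B"
      by (simp add: algebra_simps)
    also have "\<dots> \<le> (1 - \<beta>) * b * tp.prob B"
      using \<open>G - \<beta> * F \<le> _\<close> by (intro mult_right_mono) auto
    also have "\<dots> \<le> (1 - \<beta>) * b * 1"
      using \<beta> ab(1) \<open>a \<le> b\<close> by (intro mult_left_mono) auto
    finally have "tp.prob B - tq.prob B \<le> (1 - \<beta>) * b / G"
      using G ab(1) by (simp add: field_simps)
    also have "\<dots> \<le> (1 - \<beta>) * b / a"
      using G ab(1) \<beta> \<open>a \<le> b\<close> by (intro divide_left_mono) auto
    finally show ?thesis by simp
  qed
  have "space p - A \<in> sets p" "A \<in> tp.events" "A \<in> tq.events" using A sets by auto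
  then have "tq.prob A - tp.prob A = tp.prob (space p - A) - tq.prob (space p - A)"
    using tp.prob_compl[of A] tq.prob_compl[of A] sp by auto
  with diff[OF A] diff[OF \<open>space p - A \<in> sets p\<close>] show ?thesis by linarith
qed

lemma tilt_distr:
  assumes "T \<in> M \<rightarrow>\<^sub>M N" "f \<in> borel_measurable N"
  shows "tilt f (distr M N T) = distr (tilt (\<lambda>x. f (T x)) M) N T"
  using assms by (simp add: tilt_def density_distr integral_distr)

section \<open>Sampling with and without replacement\<close>

text \<open>
  The birthday bound: \<open>k\<close> independent uniform draws from \<open>n\<close> items are all distinct with
  probability \<open>\<Prod>i<k. 1 - i / n\<close>, at least \<open>1 - \<Sum>i<k. i / n\<close>.
\<close>

lemma card_injections_ge:
  assumes "n \<ge> 1" "k \<le> n"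
  shows "1 - real k * (real k - 1) / (2 * real n) \<le>
    real (card {g \<in> {1..k} \<rightarrow>\<^sub>E {1..n}. inj_on g {1..k}}) / real n ^ k"
proof -
  have "1 - real k * (real k - 1) / (2 * real n) \<le> (\<Prod>i<k. 1 - real i / real n)"
    using \<open>k \<le> n\<close>
  proof (induction k)
    case (Suc k)
    define c where "c = real k * (real k - 1) / (2 * real n)"
    have "0 \<le> c" unfolding c_def by (cases k) auto
    have expand: "1 - c - x \<le> (1 - c) * (1 - x)" if "0 \<le> x" for x
      using mult_nonneg_nonneg[OF \<open>0 \<le> c\<close> that] by (simp add: algebra_simps)
    have "1 - real (Suc k) * (real (Suc k) - 1) / (2 * real n) = 1 - c - real k / real n"
      using \<open>n \<ge> 1\<close> by (simp add: c_def field_simps)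
    also have "\<dots> \<le> (1 - c) * (1 - real k / real n)"
      by (rule expand) simp
    also have "\<dots> \<le> (\<Prod>i<k. 1 - real i / real n) * (1 - real k / real n)"
      using Suc \<open>n \<ge> 1\<close> by (intro mult_right_mono) (auto simp: c_def field_simps)
    finally show ?case by simp
  qed simp
  also have "\<dots> = (\<Prod>i<k. real (n - i) / real n)"
    using assms by (intro prod.cong) (auto simp: of_nat_diff field_simps)
  also have "\<dots> = real (\<Prod>i=0..<k. n - i) / real n ^ k"
    by (simp add: prod_dividef lessThan_atLeast0)
  also have "(\<Prod>i=0..<k. n - i) = card {g \<in> {1..k} \<rightarrow>\<^sub>E {1..n}. inj_on g {1..k}}"
    by (subst card_inj_on_subset_funcset) auto
  finally show ?thesis .
qed

text \<open>
  Sampling from the empirical measure amounts to choosing independent uniform indices first and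
  evaluating \<open>z\<close> at them afterwards.
\<close>

lemma PiM_empirical:
  fixes z :: "nat \<Rightarrow> 'a::topological_space"
  shows "PiM {1..k} (\<lambda>_. empirical n z) =
    distr (PiM {1..k} (\<lambda>_. measure_pmf (pmf_of_set {1..n}))) (borel_power k) (compose {1..k} z)"
proof -
  have 1: "product_prob_space (\<lambda>_::nat. measure_pmf (pmf_of_set {1..n}))"
    by (rule product_prob_spaceI) (rule measure_pmf.prob_space_axioms)
  have 2: "product_prob_space (\<lambda>_::nat. empirical n z)"
    by (rule product_prob_spaceI) (rule prob_space_empirical)
  have "distr (measure_pmf (pmf_of_set {1..n})) (empirical n z) z = empirical n z"
    unfolding empirical_def by (rule distr_cong) auto
  then have "PiM {1..k} (\<lambda>_. empirical n z) =
      distr (PiM {1..k} (\<lambda>_. measure_pmf (pmf_of_set {1..n}))) (PiM {1..k} (\<lambda>_. empirical n z)) (compose {1..k} z)"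
    by (subst distr_PiM_finite_prob_space[OF _ 1 2]) (auto simp: empirical_def)
  also have "\<dots> = distr (PiM {1..k} (\<lambda>_. measure_pmf (pmf_of_set {1..n}))) (borel_power k) (compose {1..k} z)"
    by (intro distr_cong sets_PiM_cong) auto
  finally show ?thesis .
qed

text \<open>
  Drawing \<open>k\<close> times with replacement from \<open>z 1, \<dots>, z n\<close> selects each index vector \<open>g\<close> with
  probability \<open>1 / n ^ k\<close>; the bound keeps only the vectors without repeated index.
\<close>

lemma emeasure_PiM_empirical_ge:
  fixes z :: "nat \<Rightarrow> 'a::topological_space"
  assumes n: "n \<ge> 1" and A: "A \<in> sets (borel_power k)"
  shows "(\<Sum>g \<in> {g \<in> {1..k} \<rightarrow>\<^sub>E {1..n}. inj_on g {1..k}}. indicator A (compose {1..k} z g)) * ennreal (1 / real n ^ k)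
    \<le> emeasure (PiM {1..k} (\<lambda>_. empirical n z)) A"
proof -
  define U where "U = PiM {1..k} (\<lambda>_. measure_pmf (pmf_of_set {1..n}))"
  define J where "J = {g \<in> {1..k} \<rightarrow>\<^sub>E {1..n}. inj_on g {1..k}}"
  define S where "S = {g \<in> J. compose {1..k} z g \<in> A}"
  have "finite J" unfolding J_def by (intro finite_subset[OF _ finite_PiE[of "{1..k}" "\<lambda>_. {1..n}"]]) auto
  then have "finite S" by (simp add: S_def)
  interpret product_prob_space "\<lambda>_. measure_pmf (pmf_of_set {1..n})" "{1..k}"
    by (rule product_prob_spaceI) (rule measure_pmf.prob_space_axioms)
  have single: "{g} \<in> sets U" "emeasure U {g} = ennreal (1 / real n ^ k)" if "g \<in> J" for g
  proof -
    have g: "{g} = (\<Pi>\<^sub>E i\<in>{1..k}. {g i})"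
      using that PiE_singleton[of g "{1..k}"] by (auto simp: J_def PiE_def)
    show "{g} \<in> sets U"
      unfolding U_def g by (intro sets_PiM_I_finite) auto
    have "emeasure U {g} = (\<Prod>i\<in>{1..k}. emeasure (measure_pmf (pmf_of_set {1..n})) {g i})"
      unfolding U_def g by (intro emeasure_PiM) auto
    also have "\<dots> = (\<Prod>i\<in>{1..k}. ennreal (1 / real n))"
      using that n by (intro prod.cong) (auto simp: J_def emeasure_pmf_single pmf_of_set PiE_def Pi_def)
    also have "\<dots> = ennreal (1 / real n ^ k)"
      by (simp add: ennreal_power power_divide)
    finally show "emeasure U {g} = ennreal (1 / real n ^ k)" .
  qed
  have m: "compose {1..k} z \<in> U \<rightarrow>\<^sub>M borel_power k"
    unfolding U_def compose_def
    by (intro measurable_restrict measurable_compose[OF measurable_component_singleton]) auto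
  have "(\<Sum>g\<in>J. indicator A (compose {1..k} z g)) * ennreal (1 / real n ^ k)
      = (\<Sum>g\<in>S. ennreal (1 / real n ^ k))"
    unfolding S_def using \<open>finite J\<close>
    by (simp add: indicator_def sum_distrib_right sum.inter_filter Int_def if_distrib[of "\<lambda>x. x * _"] cong: if_cong)
  also have "\<dots> = emeasure U S"
    using \<open>finite S\<close> single by (subst emeasure_eq_sum_singleton) (auto simp: S_def)
  also have "\<dots> \<le> emeasure U (compose {1..k} z -` A \<inter> space U)"
  proof (rule emeasure_mono)
    show "S \<subseteq> compose {1..k} z -` A \<inter> space U"
      using sets.sets_into_space[OF single(1)] by (auto simp: S_def)
  qed (use m A in measurable)
  also have "\<dots> = emeasure (PiM {1..k} (\<lambda>_. empirical n z)) A"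
    unfolding PiM_empirical U_def[symmetric] using m A by (simp add: emeasure_distr)
  finally show ?thesis by (simp add: J_def)
qed

lemma injection_extends_to_permutation:
  assumes g: "g \<in> {1..k} \<rightarrow> {1..n}" "inj_on g {1..k}" and "k \<le> n"
  obtains \<pi> where "\<pi> permutes {1..n::nat}" "\<And>i. i \<in> {1..k} \<Longrightarrow> \<pi> i = g i"
proof -
  have sub: "g ` {1..k} \<subseteq> {1..n}" "{1..k} \<subseteq> {1..n}" using assms by auto
  have "card ({1..n} - {1..k}) = card ({1..n} - g ` {1..k})"
    using sub card_image[OF g(2)] by (simp add: card_Diff_subset)
  then obtain h where h: "bij_betw h ({1..n} - {1..k}) ({1..n} - g ` {1..k})"
    using finite_same_card_bij[of "{1..n} - {1..k}" "{1..n} - g ` {1..k}"] by auto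
  define \<pi> where "\<pi> i = (if i \<in> {1..k} then g i else if i \<in> {1..n} then h i else i)" for i
  have "bij_betw \<pi> {1..k} (g ` {1..k})"
    using inj_on_imp_bij_betw[OF g(2)] bij_betw_cong[of "{1..k}" \<pi> g] by (simp add: \<pi>_def)
  moreover have "bij_betw \<pi> ({1..n} - {1..k}) ({1..n} - g ` {1..k})"
    using h bij_betw_cong[of "{1..n} - {1..k}" \<pi> h] by (simp add: \<pi>_def)
  ultimately have "bij_betw \<pi> ({1..k} \<union> ({1..n} - {1..k})) (g ` {1..k} \<union> ({1..n} - g ` {1..k}))"
    by (rule bij_betw_combine) blast
  moreover have "{1..k} \<union> ({1..n} - {1..k}) = {1..n}" "g ` {1..k} \<union> ({1..n} - g ` {1..k}) = {1..n}"
    using sub by auto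
  ultimately have "bij_betw \<pi> {1..n} {1..n}" by simp
  moreover have "\<pi> i = i" if "i \<notin> {1..n}" for i
    using that sub by (auto simp: \<pi>_def)
  ultimately have "\<pi> permutes {1..n}" by (rule bij_imp_permutes)
  then show ?thesis by (rule that) (simp add: \<pi>_def)
qed

text \<open>
  An injective choice of \<open>k\<close> coordinates extends to a permutation of all \<open>n\<close>, so under an
  exchangeable law every such choice has the law of the first \<open>k\<close> coordinates.
\<close>

lemma exchangeable_distr_injection:
  fixes M :: "(nat \<Rightarrow> 'a::topological_space) measure"
  assumes ex: "exchangeable n M" and g: "g \<in> {1..k} \<rightarrow> {1..n}" "inj_on g {1..k}" and "k \<le> n"
  shows "distr M (borel_power k) (\<lambda>z. compose {1..k} z g) = marginal k M"
proof -
  have s: "sets M = sets (borel_power n)" using ex by (simp add: exchangeable_def)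
  obtain \<pi> where \<pi>: "\<pi> permutes {1..n}" "\<And>i. i \<in> {1..k} \<Longrightarrow> \<pi> i = g i"
    using injection_extends_to_permutation[OF g \<open>k \<le> n\<close>] by blast
  have p: "(\<lambda>x. \<lambda>i\<in>{1..n}. x (\<pi> i)) \<in> M \<rightarrow>\<^sub>M borel_power n"
    unfolding measurable_cong_sets[OF s refl] using permutes_in_image[OF \<pi>(1)]
    by (intro measurable_restrict measurable_component_singleton) auto
  have r: "(\<lambda>x. restrict x {1..k}) \<in> borel_power n \<rightarrow>\<^sub>M (borel_power k :: (nat \<Rightarrow> 'a) measure)"
    using \<open>k \<le> n\<close> by (intro measurable_restrict_subset) auto
  have "marginal k M = distr (distr M (borel_power n) (\<lambda>x. \<lambda>i\<in>{1..n}. x (\<pi> i))) (borel_power k) (\<lambda>x. restrict x {1..k})"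
    using ex \<pi>(1) by (simp add: exchangeable_def marginal_def)
  also have "\<dots> = distr M (borel_power k) (\<lambda>z. compose {1..k} z g)"
    unfolding distr_distr[OF r p]
    using \<pi>(2) \<open>k \<le> n\<close> by (intro distr_cong) (auto simp: compose_def fun_eq_iff)
  finally show ?thesis by simp
qed

text \<open>
  Given the point \<open>z\<close>, draws with replacement from its coordinates are independent with the
  empirical measure of \<open>z\<close> as common law, so this is a mixture of powers.
\<close>

definition with_replacement ::
    "nat \<Rightarrow> nat \<Rightarrow> (nat \<Rightarrow> 'a::topological_space) measure \<Rightarrow> (nat \<Rightarrow> 'a) measure" where
  "with_replacement k n M = M \<bind> (\<lambda>z. PiM {1..k} (\<lambda>_. empirical n z))"

lemma empirical_measurable_prob_algebra:
  assumes "n \<ge> 1"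
  shows "empirical n \<in> borel_power n \<rightarrow>\<^sub>M prob_algebra (borel :: 'a::polish_space measure)"
  using measurable_comp[OF empirical_measurable_weak_borel[OF assms] weak_borel_measurable_prob_algebra]
  by (simp add: comp_def)

lemma PiM_empirical_measurable:
  assumes "n \<ge> 1"
  shows "(\<lambda>z. PiM {1..k} (\<lambda>_. empirical n z)) \<in> borel_power n \<rightarrow>\<^sub>M prob_algebra (borel_power k :: (nat \<Rightarrow> 'a::polish_space) measure)"
  using empirical_measurable_prob_algebra[OF assms] by (intro PiM_measurable_prob_algebra) auto

lemma
  fixes M :: "(nat \<Rightarrow> 'a::polish_space) measure"
  assumes "n \<ge> 1" "prob_space M" and s: "sets M = sets (borel_power n)"
  shows prob_space_with_replacement: "prob_space (with_replacement k n M)"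
    and sets_with_replacement: "sets (with_replacement k n M) = sets (borel_power k)"
proof -
  have K: "(\<lambda>z. PiM {1..k} (\<lambda>_. empirical n z)) \<in> M \<rightarrow>\<^sub>M prob_algebra (borel_power k)"
    unfolding measurable_cong_sets[OF s refl] using assms(1) by (rule PiM_empirical_measurable)
  have M: "M \<in> space (prob_algebra M)" using assms(2) by (simp add: space_prob_algebra)
  show "prob_space (with_replacement k n M)" "sets (with_replacement k n M) = sets (borel_power k)"
    unfolding with_replacement_def using prob_space_bind'[OF M K] sets_bind'[OF M K] by auto
qed

text \<open>
  On the event that the \<open>k\<close> drawn indices are distinct, sampling with replacement from an
  exchangeable vector yields the law of its first \<open>k\<close> coordinates. Hence that law, scaled by the
  probability of distinct indices, is dominated by the law of the sample.
\<close>

lemma with_replacement_ge: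
  fixes M :: "(nat \<Rightarrow> 'a::polish_space) measure"
  assumes n: "n \<ge> 1" and kn: "k \<le> n" and "prob_space M" and ex: "exchangeable n M"
    and A: "A \<in> sets (borel_power k)"
  shows "real (card {g \<in> {1..k} \<rightarrow>\<^sub>E {1..n}. inj_on g {1..k}}) / real n ^ k * measure (marginal k M) A
    \<le> measure (with_replacement k n M) A"
proof -
  define J where "J = {g \<in> {1..k} \<rightarrow>\<^sub>E {1..n}. inj_on g {1..k}}"
  define c where "c = ennreal (1 / real n ^ k)"
  have s: "sets M = sets (borel_power n)" using ex by (simp add: exchangeable_def)
  interpret M: prob_space M by fact
  interpret q: prob_space "with_replacement k n M"
    by (rule prob_space_with_replacement[OF n \<open>prob_space M\<close> s])
  have cm: "(\<lambda>z. compose {1..k} z g) \<in> M \<rightarrow>\<^sub>M borel_power k" if "g \<in> J" for g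
    unfolding measurable_cong_sets[OF s refl] compose_def using that
    by (intro measurable_restrict measurable_component_singleton) (auto simp: J_def)
  have r: "(\<lambda>x. restrict x {1..k}) \<in> M \<rightarrow>\<^sub>M borel_power k"
    unfolding measurable_cong_sets[OF s refl] using kn by (intro measurable_restrict_subset) auto
  interpret p: prob_space "marginal k M"
    unfolding marginal_def using r by (rule M.prob_space_distr)
  have im: "(\<lambda>z. indicator A (compose {1..k} z g) :: ennreal) \<in> borel_measurable M" if "g \<in> J" for g
    by (rule measurable_compose[OF cm[OF that] borel_measurable_indicator[OF A]])
  have "(\<integral>\<^sup>+z. indicator A (compose {1..k} z g) \<partial>M) = emeasure (marginal k M) A" if "g \<in> J" for g
  proof -
    have "(\<integral>\<^sup>+z. indicator A (compose {1..k} z g) \<partial>M) = emeasure (distr M (borel_power k) (\<lambda>z. compose {1..k} z g)) A"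
      using nn_integral_distr[OF cm[OF that], of "indicator A"] A by simp
    also have "distr M (borel_power k) (\<lambda>z. compose {1..k} z g) = marginal k M"
      using that by (intro exchangeable_distr_injection[OF ex _ _ kn]) (auto simp: J_def)
    finally show ?thesis .
  qed
  then have "of_nat (card J) * emeasure (marginal k M) A * c
      = (\<Sum>g\<in>J. \<integral>\<^sup>+z. indicator A (compose {1..k} z g) \<partial>M) * c"
    by simp
  also have "\<dots> = (\<integral>\<^sup>+z. (\<Sum>g\<in>J. indicator A (compose {1..k} z g)) * c \<partial>M)"
    using im by (simp add: nn_integral_sum nn_integral_multc)
  also have "\<dots> \<le> (\<integral>\<^sup>+z. emeasure (PiM {1..k} (\<lambda>_. empirical n z)) A \<partial>M)"
    unfolding J_def c_def using n A by (intro nn_integral_mono emeasure_PiM_empirical_ge)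
  also have "\<dots> = emeasure (with_replacement k n M) A"
    unfolding with_replacement_def
  proof (rule emeasure_bind[symmetric, OF M.not_empty _ A])
    show "(\<lambda>z. PiM {1..k} (\<lambda>_. empirical n z)) \<in> M \<rightarrow>\<^sub>M subprob_algebra (borel_power k)"
      unfolding measurable_cong_sets[OF s refl]
      by (rule measurable_prob_algebraD[OF PiM_empirical_measurable[OF n]])
  qed
  finally have "of_nat (card J) * emeasure (marginal k M) A * c \<le> emeasure (with_replacement k n M) A" .
  moreover have "of_nat (card J) * emeasure (marginal k M) A * c =
      ennreal (real (card J) * measure (marginal k M) A * (1 / real n ^ k))"
    by (simp only: c_def p.emeasure_eq_measure ennreal_of_nat_eq_real_of_nat ennreal_mult
        of_nat_0_le_iff measure_nonneg mult_nonneg_nonneg zero_le_divide_1_iff zero_le_power)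
  ultimately show ?thesis by (simp add: q.emeasure_eq_measure J_def)
qed

section \<open>The mixture and the bound\<close>

lemma bounded_weight_component:
  assumes "bounded_weight N f" "i \<in> I"
  shows "bounded_weight (PiM I (\<lambda>_. N)) (\<lambda>x. f (x i))"
proof -
  have "(\<lambda>x. f (x i)) \<in> borel_measurable (PiM I (\<lambda>_. N))"
    using assms(2) bounded_weight_measurable[OF assms(1)]
    by (rule measurable_compose[OF measurable_component_singleton])
  moreover obtain a b where "0 < a" "\<And>x. x \<in> space N \<Longrightarrow> a \<le> f x \<and> f x \<le> b"
    using assms(1) by (auto simp: bounded_weight_def)
  moreover have "x i \<in> space N" if "x \<in> space (PiM I (\<lambda>_. N))" for x
    using measurable_space[OF measurable_component_singleton[OF assms(2)] that] .
  ultimately show ?thesis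
    unfolding bounded_weight_def by blast
qed

text \<open>
  The mixing measure is the law of the empirical measure of \<open>z\<close>, where \<open>z\<close> has the law \<open>M\<close>
  tilted by \<open>W z\<close>, the product of the first \<open>k\<close> normalising constants of the tilts of that
  empirical measure. Under the \<open>k\<close>-marginal these constants cancel, and only one global
  normalisation remains.
\<close>

lemma ex_mixture_marginal_eq_tilt:
  fixes l :: "nat \<Rightarrow> 'a::polish_space \<Rightarrow> real" and M :: "(nat \<Rightarrow> 'a) measure"
  assumes n: "n \<ge> 1" and kn: "k \<le> n" and l: "\<And>i. i \<in> {1..n} \<Longrightarrow> bounded_weight borel (l i)"
    and "prob_space M" and s: "sets M = sets (borel_power n)"
  shows "\<exists>Q. mixture_of_weighted_iid n l Q \<and>
    marginal k Q = tilt (\<lambda>x. \<Prod>i=1..k. l i (x i)) (with_replacement k n M)"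
proof -
  define f where "f x = (\<Prod>i=1..k. l i (x i))" for x :: "nat \<Rightarrow> 'a"
  define W where "W z = (\<Prod>i=1..k. \<integral>x. l i x \<partial>empirical n z)" for z :: "nat \<Rightarrow> 'a"
  define q where "q = with_replacement k n M"
  interpret M: prob_space M by fact
  interpret q: prob_space q
    unfolding q_def using n \<open>prob_space M\<close> s by (rule prob_space_with_replacement)
  have sq: "sets q = sets (borel_power k)"
    unfolding q_def using n \<open>prob_space M\<close> s by (rule sets_with_replacement)
  have lk: "bounded_weight borel (l i)" if "i \<in> {1..k}" for i using l that kn by auto
  have emp: "empirical n z \<in> prob_measures" for z :: "nat \<Rightarrow> 'a"
    by (simp add: prob_measures_def prob_space_empirical)
  have f: "bounded_weight q f"
    unfolding f_def bounded_weight_cong_sets[OF sq]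
    by (intro bounded_weight_prod bounded_weight_component lk) auto
  have fk: "f \<in> borel_measurable (borel_power k)"
    using bounded_weight_measurable[OF f] unfolding measurable_cong_sets[OF sq refl] .
  have empw: "empirical n \<in> M \<rightarrow>\<^sub>M (weak_borel :: 'a measure measure)"
    unfolding measurable_cong_sets[OF s refl] using n by (rule empirical_measurable_weak_borel)
  have K: "(\<lambda>z. PiM {1..k} (\<lambda>_. empirical n z)) \<in> M \<rightarrow>\<^sub>M subprob_algebra (borel_power k)"
    unfolding measurable_cong_sets[OF s refl] by (rule measurable_prob_algebraD[OF PiM_empirical_measurable[OF n]])
  have W: "bounded_weight M W"
    unfolding W_def
  proof (intro bounded_weight_prod)
    fix i assume i: "i \<in> {1..k}"
    obtain a b where ab: "0 < a" "\<And>x. a \<le> l i x \<and> l i x \<le> b"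
      using lk[OF i] by (auto simp: bounded_weight_def)
    have "(\<lambda>z. \<integral>x. l i x \<partial>empirical n z) \<in> borel_measurable M"
    proof (rule measurable_compose[OF _ integral_measurable_subprob_algebra])
      show "empirical n \<in> M \<rightarrow>\<^sub>M subprob_algebra borel"
        unfolding measurable_cong_sets[OF s refl]
        using n by (intro measurable_prob_algebraD empirical_measurable_prob_algebra)
    qed (rule bounded_weight_measurable[OF lk[OF i]])
    moreover have "a \<le> (\<integral>x. l i x \<partial>empirical n z) \<and> (\<integral>x. l i x \<partial>empirical n z) \<le> b" for z
    proof -
      interpret prob_space "empirical n z" by (rule prob_space_empirical)
      have "integrable (empirical n z) (l i)"
        by (rule bounded_weight_integrable[OF bounded_weight_prob_measures[OF lk[OF i] emp]])
      then show ?thesis using ab by (intro conjI integral_ge_const integral_le_const) auto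
    qed
    ultimately show "bounded_weight M (\<lambda>z. \<integral>x. l i x \<partial>empirical n z)"
      using ab(1) by (auto simp: bounded_weight_def)
  qed
  have unnorm: "ennreal (W z) * emeasure (weighted_iid k l (empirical n z)) A =
      (\<integral>\<^sup>+x. ennreal (f x) * indicator A x \<partial>PiM {1..k} (\<lambda>_. empirical n z))"
    if "A \<in> sets (borel_power k)" for z A
    unfolding W_def f_def using lk emp that by (rule weighted_iid_unnormalized)
  have fA: "(\<integral>\<^sup>+x. ennreal (f x) * indicator A x \<partial>q) =
      (\<integral>\<^sup>+z. ennreal (W z) * emeasure (weighted_iid k l (empirical n z)) A \<partial>M)"
    if A: "A \<in> sets (borel_power k)" for A
  proof -
    have "(\<lambda>x. ennreal (f x) * indicator A x) \<in> borel_measurable (borel_power k)"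
      using fk A by auto
    then show ?thesis
      unfolding q_def with_replacement_def unnorm[OF A] by (rule nn_integral_bind[OF _ K])
  qed
  have wk: "weighted_iid k l \<in> weak_borel \<rightarrow>\<^sub>M prob_algebra (borel_power k)"
    by (rule measurable_compose[OF weak_borel_measurable_prob_algebra weighted_iid_measurable[OF lk]])
  have wn: "weighted_iid n l \<in> weak_borel \<rightarrow>\<^sub>M prob_algebra (borel_power n)"
    by (rule measurable_compose[OF weak_borel_measurable_prob_algebra weighted_iid_measurable[OF l]])
  \<comment> \<open>Taking the whole space for \<open>A\<close> in \<open>fA\<close> shows that \<open>W\<close> and \<open>f\<close> have the same normalising constant.\<close>
  have "ennreal (\<integral>x. f x \<partial>q) = (\<integral>\<^sup>+x. ennreal (f x) * indicator (space (borel_power k)) x \<partial>q)"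
    unfolding q.bounded_weight_nn_integral[OF f, symmetric]
    using sets_eq_imp_space_eq[OF sq] by (intro nn_integral_cong) auto
  also have "\<dots> = (\<integral>\<^sup>+z. ennreal (W z) \<partial>M)"
  proof (subst fA)
    have "emeasure (weighted_iid k l (empirical n z)) (space (borel_power k)) = 1" for z
    proof -
      have w: "prob_space (weighted_iid k l (empirical n z))"
        "sets (weighted_iid k l (empirical n z)) = sets (borel_power k)"
        using measurable_space[OF wk, of "empirical n z"] emp by (auto simp: space_prob_algebra)
      show ?thesis
        using prob_space.emeasure_space_1[OF w(1)] sets_eq_imp_space_eq[OF w(2)] by simp
    qed
    then show "(\<integral>\<^sup>+z. ennreal (W z) * emeasure (weighted_iid k l (empirical n z)) (space (borel_power k)) \<partial>M)
        = (\<integral>\<^sup>+z. ennreal (W z) \<partial>M)" by simp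
  qed auto
  also have "\<dots> = ennreal (\<integral>z. W z \<partial>M)" by (rule M.bounded_weight_nn_integral[OF W])
  finally have G: "(\<integral>z. W z \<partial>M) = (\<integral>x. f x \<partial>q)"
    using M.bounded_weight_integral_pos[OF W] q.bounded_weight_integral_pos[OF f] by simp
  define G where "G = (\<integral>x. f x \<partial>q)"
  have Gpos: "G > 0" unfolding G_def by (rule q.bounded_weight_integral_pos[OF f])

  interpret tM: prob_space "tilt W M" by (rule M.prob_space_tilt[OF W])
  define R where "R = distr (tilt W M) weak_borel (empirical n)"
  have empt: "empirical n \<in> tilt W M \<rightarrow>\<^sub>M (weak_borel :: 'a measure measure)"
    using empw by simp
  interpret R: prob_space R unfolding R_def using empt by (rule tM.prob_space_distr)
  have sR: "sets R = sets weak_borel" by (simp add: R_def)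
  define Q where "Q = R \<bind> weighted_iid n l"
  have wnR: "weighted_iid n l \<in> R \<rightarrow>\<^sub>M subprob_algebra (borel_power n)"
    unfolding measurable_cong_sets[OF sR refl] using wn by (rule measurable_prob_algebraD)
  have sQ: "sets Q = sets (borel_power n)"
    unfolding Q_def using wnR R.not_empty by (intro sets_bind[OF sets_kernel]) auto
  have eQ: "emeasure Q A = (\<integral>\<^sup>+\<mu>. emeasure (weighted_iid n l \<mu>) A \<partial>R)" if "A \<in> sets (borel_power n)" for A
    unfolding Q_def using R.not_empty wnR that by (rule emeasure_bind)
  have "mixture_of_weighted_iid n l Q"
    unfolding mixture_of_weighted_iid_def using sQ R.prob_space_axioms sR eQ by blast
  moreover have "marginal k Q = tilt f q"
  proof (rule measure_eqI)
    show "sets (marginal k Q) = sets (tilt f q)" by (simp add: marginal_def sq)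
    fix A assume "A \<in> sets (marginal k Q)"
    then have A: "A \<in> sets (borel_power k)" by (simp add: marginal_def)
    have r: "(\<lambda>x. restrict x {1..k}) \<in> borel_power n \<rightarrow>\<^sub>M (borel_power k :: (nat \<Rightarrow> 'a) measure)"
      using kn by (intro measurable_restrict_subset) auto
    have "marginal k Q = R \<bind> (\<lambda>\<mu>. distr (weighted_iid n l \<mu>) (borel_power k) (\<lambda>x. restrict x {1..k}))"
      unfolding marginal_def Q_def using wnR R.not_empty r by (rule distr_bind)
    also have "\<dots> = R \<bind> weighted_iid k l"
      using restrict_weighted_iid[OF l _ kn] sets_eq_imp_space_eq[OF sR] by (intro bind_cong) auto
    finally have "emeasure (marginal k Q) A = (\<integral>\<^sup>+\<mu>. emeasure (weighted_iid k l \<mu>) A \<partial>R)"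
      using emeasure_bind[OF R.not_empty _ A, of "weighted_iid k l"] measurable_prob_algebraD[OF wk]
      unfolding measurable_cong_sets[OF sR refl] by simp
    also have "\<dots> = (\<integral>\<^sup>+z. emeasure (weighted_iid k l (empirical n z)) A \<partial>tilt W M)"
      unfolding R_def
      using empt measurable_emeasure_kernel[OF measurable_prob_algebraD[OF wk] A]
      by (subst nn_integral_distr) auto
    also have "\<dots> = (\<integral>\<^sup>+z. ennreal (W z / G) * emeasure (weighted_iid k l (empirical n z)) A \<partial>M)"
      unfolding tilt_def G G_def[symmetric]
      using bounded_weight_measurable[OF W]
        measurable_compose[OF empw measurable_emeasure_kernel[OF measurable_prob_algebraD[OF wk] A]]
      by (intro nn_integral_density) auto
    also have "\<dots> = (\<integral>\<^sup>+z. ennreal (W z) * emeasure (weighted_iid k l (empirical n z)) A / ennreal G \<partial>M)"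
      using Gpos bounded_weight_pos[OF W]
      by (intro nn_integral_cong) (simp add: divide_ennreal[symmetric] less_imp_le divide_ennreal_def ac_simps)
    also have "\<dots> = (\<integral>\<^sup>+z. ennreal (W z) * emeasure (weighted_iid k l (empirical n z)) A \<partial>M) / ennreal G"
      using bounded_weight_measurable[OF W]
        measurable_compose[OF empw measurable_emeasure_kernel[OF measurable_prob_algebraD[OF wk] A]]
      by (intro nn_integral_divide) auto
    also have "\<dots> = emeasure (tilt f q) A"
      using A sq by (simp add: q.emeasure_tilt[OF f] fA G_def)
    finally show "emeasure (marginal k Q) A = emeasure (tilt f q) A" .
  qed
  ultimately show ?thesis unfolding f_def q_def by blast
qed

text \<open>
  A positive ratio forces a finite supremum, because in \<open>ereal\<close> a finite number divided by infinity is zero, and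
  then also a positive infimum.
\<close>

lemma weight_ratio_bounds:
  fixes f :: "'a \<Rightarrow> real"
  assumes "\<And>x. 0 < f x" "0 < weight_ratio f"
  obtains a b where "0 < a" "\<And>x. a \<le> f x \<and> f x \<le> b" "weight_ratio f = a / b"
proof -
  define I S where "I = (INF x. ereal (f x))" and "S = (SUP x. ereal (f x))"
  have I: "I \<le> ereal (f x)" and S: "ereal (f x) \<le> S" for x
    unfolding I_def S_def by (auto intro: INF_lower SUP_upper)
  have "0 \<le> I" unfolding I_def using assms(1) by (intro INF_greatest) (simp add: less_imp_le)
  have r: "weight_ratio f = real_of_ereal (I / S)"
    by (simp add: weight_ratio_def I_def S_def)
  have "S \<noteq> \<infinity>" using assms(2) unfolding r by auto
  moreover have "S \<noteq> -\<infinity>" using S[of undefined] by auto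
  ultimately obtain b where b: "S = ereal b" by (cases S) auto
  obtain a where a: "I = ereal a" using I[of undefined] \<open>0 \<le> I\<close> by (cases I) auto
  have ab: "a \<le> f x \<and> f x \<le> b" for x using I[of x] S[of x] a b by simp
  then have "0 < b" using assms(1)[of undefined] by (meson less_le_trans)
  then have "weight_ratio f = a / b" unfolding r a b by simp
  moreover have "0 < a" using \<open>0 < b\<close> assms(2) \<open>weight_ratio f = a / b\<close> by (simp add: zero_less_divide_iff)
  ultimately show ?thesis using ab that by blast
qed

theorem theorem3p1:
  fixes l :: "nat \<Rightarrow> 'a::polish_space \<Rightarrow> real"
    and P :: "(nat \<Rightarrow> 'a) measure"
    and n k :: nat
  assumes "n \<ge> 1"
    and "\<And>i. i \<in> {1..n} \<Longrightarrow> l i \<in> weights"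
    and "weighted_exchangeable n l P"
    and "1 \<le> k" and "k \<le> n"
    and "\<And>i. i \<in> {1..n} \<Longrightarrow> weight_ratio (l i) > 0"
  shows "\<exists>Q. mixture_of_weighted_iid n l Q \<and>
    tv_dist (marginal k P) (marginal k Q) \<le>
      real k * (real k - 1) / (2 * real n) * inverse (\<Prod>i=1..k. weight_ratio (l i))
      + ((\<Prod>i=k+1..n. weight_ratio (l i)) powr (-1/2) - 1) / ((\<Prod>i=k+1..n. weight_ratio (l i)) powr (-1/2) + 1)"
proof -
  define M where "M = unweighted n l P"
  have "prob_space P" and sP: "sets P = sets (borel_power n)" and "prob_space M" and ex: "exchangeable n M"
    using assms(3) by (auto simp: weighted_exchangeable_def M_def)
  have sM: "sets M = sets (borel_power n)" using ex by (simp add: exchangeable_def)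
  interpret P: prob_space P by fact
  interpret M: prob_space M by fact
  have lpos: "0 < l i x" and lm: "l i \<in> borel_measurable borel" if "i \<in> {1..n}" for i x
    using assms(2)[OF that] by (auto simp: weights_def)
  have "\<forall>i\<in>{1..n}. \<exists>a b. 0 < a \<and> (\<forall>x. a \<le> l i x \<and> l i x \<le> b) \<and> weight_ratio (l i) = a / b"
  proof
    fix i assume "i \<in> {1..n}"
    from weight_ratio_bounds[OF lpos[OF this] assms(6)[OF this]]
    show "\<exists>a b. 0 < a \<and> (\<forall>x. a \<le> l i x \<and> l i x \<le> b) \<and> weight_ratio (l i) = a / b" by metis
  qed
  then obtain a b where ab: "\<And>i. i \<in> {1..n} \<Longrightarrow> 0 < a i"
    "\<And>i x. i \<in> {1..n} \<Longrightarrow> a i \<le> l i x \<and> l i x \<le> b i"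
    "\<And>i. i \<in> {1..n} \<Longrightarrow> weight_ratio (l i) = a i / b i"
    by metis
  have bpos: "0 < b i" if "i \<in> {1..n}" for i
    using ab(1)[OF that] ab(2)[OF that, of undefined] by linarith
  have l: "bounded_weight borel (l i)" if "i \<in> {1..n}" for i
    using lm[OF that] ab(1,2)[OF that] by (auto simp: bounded_weight_def)
  have prod_bounds: "0 < (\<Prod>i\<in>I. a i)" "(\<Prod>i\<in>I. a i) \<le> (\<Prod>i\<in>I. l i (x i)) \<and> (\<Prod>i\<in>I. l i (x i)) \<le> (\<Prod>i\<in>I. b i)"
    "(\<Prod>i\<in>I. b i) / (\<Prod>i\<in>I. a i) = inverse (\<Prod>i\<in>I. weight_ratio (l i))" if "I \<subseteq> {1..n}" for I x
  proof -
    have I: "i \<in> {1..n}" if "i \<in> I" for i using that \<open>I \<subseteq> {1..n}\<close> by blast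
    show "0 < (\<Prod>i\<in>I. a i)" using ab(1) I by (intro prod_pos) auto
    show "(\<Prod>i\<in>I. a i) \<le> (\<Prod>i\<in>I. l i (x i)) \<and> (\<Prod>i\<in>I. l i (x i)) \<le> (\<Prod>i\<in>I. b i)"
      using ab(1,2) lpos I by (intro conjI prod_mono) (auto simp: less_imp_le)
    have "(\<Prod>i\<in>I. weight_ratio (l i)) = (\<Prod>i\<in>I. a i) / (\<Prod>i\<in>I. b i)"
      unfolding prod_dividef[symmetric] using ab(3) I by (intro prod.cong) auto
    then show "(\<Prod>i\<in>I. b i) / (\<Prod>i\<in>I. a i) = inverse (\<Prod>i\<in>I. weight_ratio (l i))" by simp
  qed
  have prod_weight: "bounded_weight N (\<lambda>x. \<Prod>i\<in>I. l i (x i))"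
    if "I \<subseteq> J" "J \<subseteq> {1..n}" "sets N = sets (PiM J (\<lambda>_. borel))" for I J and N :: "(nat \<Rightarrow> 'a) measure"
    unfolding bounded_weight_cong_sets[OF that(3)] using that(1,2)
    by (intro bounded_weight_prod bounded_weight_component l) auto

  define f where "f x = (\<Prod>i=1..k. l i (x i))" for x :: "nat \<Rightarrow> 'a"
  define g where "g x = (\<Prod>i=k+1..n. l i (x i))" for x :: "nat \<Rightarrow> 'a"
  have split: "{1..n} = {1..k} \<union> {k+1..n}" "{1..k} \<inter> {k+1..n} = {}"
    using assms(5) by auto
  have sub: "{1..k} \<subseteq> {1..n}" "{k+1..n} \<subseteq> {1..n}" using split by auto
  have fg: "(\<Prod>i=1..n. l i (x i)) = f x * g x" for x
    unfolding f_def g_def split(1) using split(2) by (intro prod.union_disjoint) auto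
  have pos: "0 < f x" "0 < g x" for x
    unfolding f_def g_def using lpos sub by (auto intro!: prod_pos)
  have fM: "bounded_weight M f"
    unfolding f_def using sub(1) sM by (intro prod_weight[of _ "{1..n}"]) auto
  have gM: "bounded_weight M g"
    unfolding g_def using sub(2) sM by (intro prod_weight[of _ "{1..n}"]) auto
  have fgP: "bounded_weight P (\<lambda>x. f x * g x)"
    unfolding fg[symmetric] using sP by (intro prod_weight[of _ "{1..n}"]) auto

  define F where "F = (\<integral>x. f x \<partial>M)"
  have F: "F > 0" unfolding F_def by (rule M.bounded_weight_integral_pos[OF fM])
  interpret P': prob_space "tilt f M" by (rule M.prob_space_tilt[OF fM])

  have "P = density M (\<lambda>x. ennreal (f x * g x))"
  proof -
    have "density M (\<lambda>x. ennreal (f x * g x)) = density P (\<lambda>x. ennreal (1 / (f x * g x)) * ennreal (f x * g x))"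
      unfolding M_def unweighted_def fg
      using bounded_weight_measurable[OF fgP] by (intro density_density_eq) auto
    also have "\<dots> = density P (\<lambda>_. 1)"
      using bounded_weight_measurable[OF fgP]
      by (intro density_cong) (auto simp: ennreal_mult[symmetric] less_imp_le less_imp_neq[OF pos(1), symmetric]
          less_imp_neq[OF pos(2), symmetric] pos)
    also have "\<dots> = P" by (rule density_1)
    finally show ?thesis by simp
  qed
  also have "\<dots> = density M (\<lambda>x. ennreal (f x / F) * ennreal (F * g x))"
    using F bounded_weight_pos[OF fM] bounded_weight_pos[OF gM]
      bounded_weight_measurable[OF fM] bounded_weight_measurable[OF gM]
    by (intro density_cong) (auto simp: ennreal_mult[symmetric] less_imp_le)
  also have "\<dots> = density (tilt f M) (\<lambda>x. ennreal (F * g x))"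
    unfolding tilt_def F_def[symmetric] 
    using bounded_weight_measurable[OF fM] bounded_weight_measurable[OF gM]
    by (intro density_density_eq[symmetric]) auto
  finally have P_eq: "P = density (tilt f M) (\<lambda>x. ennreal (F * g x))" .

  define r where "r = (\<Prod>i=k+1..n. weight_ratio (l i))"
  have "r > 0" unfolding r_def using assms(6) sub(2) by (intro prod_pos) auto
  \<comment> \<open>The effect of the weights with index above \<open>k\<close>, measured on all of \<open>X^n\<close>.\<close>
  have tv_future: "\<bar>measure P B - measure (tilt f M) B\<bar> \<le> (r powr (-1/2) - 1) / (r powr (-1/2) + 1)"
    if B: "B \<in> sets M" for B
  proof -
    have "\<bar>measure (density (tilt f M) (\<lambda>x. ennreal (F * g x))) B - measure (tilt f M) B\<bar>
      \<le> (sqrt ((F * (\<Prod>i=k+1..n. b i)) / (F * (\<Prod>i=k+1..n. a i))) - 1) /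
        (sqrt ((F * (\<Prod>i=k+1..n. b i)) / (F * (\<Prod>i=k+1..n. a i))) + 1)"
    proof (rule P'.measure_diff_density_le)
      show "(\<lambda>x. F * g x) \<in> borel_measurable (tilt f M)"
        using bounded_weight_measurable[OF gM] by simp
      show "F * (\<Prod>i=k+1..n. a i) \<le> F * g x \<and> F * g x \<le> F * (\<Prod>i=k+1..n. b i)" for x
        unfolding g_def using prod_bounds(2)[OF sub(2), of x] F by simp
    qed (use F prod_bounds(1)[OF sub(2)] P_eq P.prob_space_axioms B in simp_all)
    moreover have "(F * (\<Prod>i=k+1..n. b i)) / (F * (\<Prod>i=k+1..n. a i)) = inverse r"
      using F prod_bounds(3)[OF sub(2)] by (simp add: r_def)
    moreover have "sqrt (inverse r) = r powr (-1/2)"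
      using \<open>r > 0\<close> by (simp add: powr_minus powr_half_sqrt real_sqrt_inverse)
    ultimately show ?thesis by (simp add: P_eq[symmetric])
  qed

  define p q where "p = marginal k M" and "q = with_replacement k n M"
  have rst: "(\<lambda>x. restrict x {1..k}) \<in> M \<rightarrow>\<^sub>M borel_power k"
    unfolding measurable_cong_sets[OF sM refl] using assms(5) by (intro measurable_restrict_subset) auto
  have p: "prob_space p" and sp: "sets p = sets (borel_power k)"
    unfolding p_def marginal_def using rst by (auto intro: M.prob_space_distr)
  have q: "prob_space q" and sq: "sets q = sets (borel_power k)"
    unfolding q_def using prob_space_with_replacement[OF assms(1) M.prob_space_axioms sM]
      sets_with_replacement[OF assms(1) M.prob_space_axioms sM] by auto
  have marg: "marginal k (tilt f M) = tilt f p"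
  proof -
    have "f \<in> borel_measurable (borel_power k)"
      unfolding f_def using sub(1) by (intro bounded_weight_measurable prod_weight[of _ "{1..k}"]) auto
    moreover have "f (restrict x {1..k}) = f x" for x
      by (simp add: f_def)
    ultimately show ?thesis
      unfolding p_def marginal_def using tilt_distr[OF rst, of f] by simp
  qed

  define \<beta> where "\<beta> = real (card {g \<in> {1..k} \<rightarrow>\<^sub>E {1..n}. inj_on g {1..k}}) / real n ^ k"
  have \<beta>: "0 \<le> \<beta>" "\<beta> \<le> 1" "1 - \<beta> \<le> real k * (real k - 1) / (2 * real n)"
  proof -
    have "card {g \<in> {1..k} \<rightarrow>\<^sub>E {1..n}. inj_on g {1..k}} \<le> card ({1..k} \<rightarrow>\<^sub>E {1..n})"
      by (intro card_mono finite_PiE) auto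
    also have "\<dots> = n ^ k" by (simp add: card_funcsetE)
    finally have "real (card {g \<in> {1..k} \<rightarrow>\<^sub>E {1..n}. inj_on g {1..k}}) \<le> real n ^ k"
      by (metis of_nat_le_iff of_nat_power)
    then show "\<beta> \<le> 1" unfolding \<beta>_def using assms(1) by simp
    show "1 - \<beta> \<le> real k * (real k - 1) / (2 * real n)"
      using card_injections_ge[OF assms(1,5)] by (simp add: \<beta>_def)
  qed (simp add: \<beta>_def)
  \<comment> \<open>The effect of drawing with instead of without replacement, under the common tilt by \<open>f\<close>.\<close>
  have tv_sampling: "\<bar>measure (tilt f p) A - measure (tilt f q) A\<bar>
      \<le> real k * (real k - 1) / (2 * real n) * inverse (\<Prod>i=1..k. weight_ratio (l i))"
    if A: "A \<in> sets (borel_power k)" for A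
  proof -
    have "\<bar>measure (tilt f p) A - measure (tilt f q) A\<bar> \<le> (1 - \<beta>) * ((\<Prod>i=1..k. b i) / (\<Prod>i=1..k. a i))"
    proof (rule measure_diff_tilt_le[OF p q _ \<beta>(1,2)])
      show "f \<in> borel_measurable p"
        unfolding f_def using sub(1) sp by (intro bounded_weight_measurable prod_weight[of _ "{1..k}"]) auto
      show "\<beta> * measure p B \<le> measure q B" if "B \<in> sets p" for B
        unfolding \<beta>_def p_def q_def using that sp
        by (intro with_replacement_ge[OF assms(1,5) M.prob_space_axioms ex]) auto
      show "(\<Prod>i=1..k. a i) \<le> f x \<and> f x \<le> (\<Prod>i=1..k. b i)" for x
        unfolding f_def using prod_bounds(2)[OF sub(1), of x] by simp
    qed (use sp sq A prod_bounds(1)[OF sub(1)] in auto)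
    also have "\<dots> \<le> real k * (real k - 1) / (2 * real n) * ((\<Prod>i=1..k. b i) / (\<Prod>i=1..k. a i))"
      using \<beta>(3) prod_bounds(1)[OF sub(1)] bpos sub(1)
      by (intro mult_right_mono divide_nonneg_pos prod_nonneg) (auto simp: less_imp_le)
    finally show ?thesis unfolding prod_bounds(3)[OF sub(1)] .
  qed

  obtain Q where Q: "mixture_of_weighted_iid n l Q" "marginal k Q = tilt f q"
    using ex_mixture_marginal_eq_tilt[OF assms(1,5) _ M.prob_space_axioms sM, of l] l
    unfolding f_def q_def by blast
  have "tv_dist (marginal k P) (marginal k Q) \<le>
      real k * (real k - 1) / (2 * real n) * inverse (\<Prod>i=1..k. weight_ratio (l i))
      + (r powr (-1/2) - 1) / (r powr (-1/2) + 1)"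
    unfolding tv_dist_def
  proof (rule cSUP_least)
    show "sets (marginal k P) \<noteq> {}" using sets.empty_sets by blast
    fix A assume "A \<in> sets (marginal k P)"
    then have A: "A \<in> sets (borel_power k)" by (simp add: marginal_def)
    define B where "B = (\<lambda>x. restrict x {1..k}) -` A \<inter> space M"
    have B: "B \<in> sets M" unfolding B_def using rst A by (rule measurable_sets)
    have rstP: "(\<lambda>x. restrict x {1..k}) \<in> P \<rightarrow>\<^sub>M borel_power k"
      using rst measurable_cong_sets[of P M] sP sM by auto
    have "measure (marginal k P) A = measure P B"
      unfolding marginal_def B_def measure_distr[OF rstP A]
      using sets_eq_imp_space_eq[of P M] sP sM by simp
    moreover have "measure (tilt f p) A = measure (tilt f M) B"
      unfolding marg[symmetric] marginal_def B_def
      using rst A by (subst measure_distr) auto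
    ultimately show "\<bar>measure (marginal k P) A - measure (marginal k Q) A\<bar> \<le>
        real k * (real k - 1) / (2 * real n) * inverse (\<Prod>i=1..k. weight_ratio (l i))
        + (r powr (-1/2) - 1) / (r powr (-1/2) + 1)"
      using tv_future[OF B] tv_sampling[OF A] unfolding Q(2) by linarith
  qed
  with Q(1) show ?thesis unfolding r_def by blast
qed

end
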